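(* Let $(A,(m_p)_{p\in\mathcal P})$ be a $\mathcal P$-tracial algebra and let $A_1,A_2$ be two sub-algebras of $A$. Then $A_1$ and $A_2$ are $\mathcal P$-free if and only if for all integers $k_1,k_2>0$, every $p\in\mathcal P_{k_1+k_2}$, all $a_1,\dots,a_{k_1}\in A_1$ and all $a_{k_1+1},\dots,a_{k_1+k_2}\in A_2$, $$m_{p^c}(a_1,\dots,a_{k_1+k_2})=\delta_{\,p^l_{k_1}\otimes p^r_{k_1}\sqsupset p}\; m_{(p^l_{k_1})^c}(a_1,\dots,a_{k_1})\; m_{(p^r_{k_1})^c}(a_{k_1+1},\dots,a_{k_1+k_2}),$$ where $\delta_{X}$ equals $1$ if $X$ holds and $0$ otherwise.
   Context: Partitions. For $k\ge 0$, $\mathcal P_k$ is the set of partitions of $\{1,\dots,k,1',\dots,k'\}$ and $\mathcal P=\bigcup_k\mathcal P_k$. A partition is drawn as a diagram with a top row $1,\dots,k$ and a bottom row $1',\dots,k'$. $\mathrm{nc}(p)$ is the number of blocks of $p$; $p\vee p'$ is the finest partition coarser than both $p$ and $p'$; $\mathrm{id}_k=\{\{i,i'\}:1\le i\le k\}$. The cycles of $p$ are the blocks of $p\vee\mathrm{id}_k$. A permutation $\sigma$ is identified with $\{\{i,\sigma(i)'\}\}$. $p\circ p'$ is obtained by putting $p'$ above $p$, identifying the bottom row of $p'$ with the top row of $p$, then erasing the middle row and keeping connections. $p\otimes p'$ is obtained by putting $p'$ to the right of $p$. Set $d(p,p')=\frac{\mathrm{nc}(p)+\mathrm{nc}(p')}{2}-\mathrm{nc}(p\vee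 p')$, and write $p\le p'$ if $d(\mathrm{id}_k,p)+d(p,p')=d(\mathrm{id}_k,p')$ (a partial order on $\mathcal P_k$). Write $p'\dashv p$ if $p'$ is coarser than $p$ and $\mathrm{nc}(p'\vee\mathrm{id}_k)=\mathrm{nc}(p\vee\mathrm{id}_k)$. Write $p'\sqsupset p$ if $p'$ is finer than $p$ and $\mathrm{nc}(p')-\mathrm{nc}(p'\vee\mathrm{id}_k)=\mathrm{nc}(p)-\mathrm{nc}(p\vee\mathrm{id}_k)$. For $p\in\mathcal P_{k_1+k_2}$, $p^l_{k_1}\in\mathcal P_{k_1}$ is the partition formed by the non-empty intersections of the blocks of $p$ with $\{1,\dots,k_1,1',\dots,k_1'\}$, and $p^r_{k_1}\in\mathcal P_{k_2}$ is the partition formed by the non-empty intersections of the blocks of $p$ with $\{k_1+1,\dots,k_1+k_2,(k_1+1)',\dots,(k_1+k_2)'\}$ (relabelled increasingly). $\mathcal P$-tracial algebra. For $p\in\mathcal P_k$, $l\ge k$ and $1\le i_1<\dots<i_k\le l$, the insertion $\mathrm{Ins}^l_{(i_1,\dots,i_k)}(p)\in\mathcal P_l$ is obtained by relabelling $j\mapsto i_j$, $j'\mapsto i_j'$ in $p$ and adding the blocks $\{i,i'\}$ for $i\notin\{i_1,\dots,i_k\}$. A $\mathcal P$-tracial algebra $(A,(m_p)_{p\in\mathcal P})$ is a (complex) algebra $A$ with $k$-linear forms $m_p:A^k\to\mathbb C$ for $p\in\mathcal P_k$ ($m_\emptyset=1$) such that (1) $m_p(a_1,\dots,a_k)=m_{\sigma\circ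 p\circ\sigma^{-1}}(a_{\sigma^{-1}(1)},\dots,a_{\sigma^{-1}(k)})$ for all $\sigma\in\mathfrak S_k$; (2) $m_p\big(\prod_{i=1}^{n_1}a^{(1)}_i,\dots,\prod_{i=1}^{n_k}a_i^{(k)}\big)=m_{\mathrm{Ins}^{n}_{\mathbf i}(p)\circ\sigma}(a^{(1)}_1,\dots,a^{(1)}_{n_1},\dots,a^{(k)}_1,\dots,a^{(k)}_{n_k})$, with $n=\sum_j n_j$, $\mathbf i=(1,1+n_1,\dots,1+n_1+\dots+n_{k-1})$ and $\sigma=(1,\dots,n_1)(n_1+1,\dots,n_1+n_2)\cdots(n_1+\dots+n_{k-1}+1,\dots,n)$. The $\mathcal P$-exclusive moments $(m_{p^c})$ and $\mathcal P$-cumulants $(\kappa_p)$ are the unique multilinear forms such that for all $k$, $p\in\mathcal P_k$: $m_p=\sum_{p'\in\mathcal P_k,\,p'\dashv p}m_{p'^c}$ and $m_p=\sum_{p'\in\mathcal P_k,\,p'\le p}\kappa_{p'}$. $\mathcal P$-freeness. Sub-algebras $A_1,A_2$ are $\mathcal P$-free if: (i) for all $k$, $p\in\mathcal P_k$, and $(a_1,\dots,a_k)$ with $a_i\in A_{\epsilon(i)}$, $\epsilon(i)\in\{1,2\}$, if some cycle of $p$ contains $i$ and $j$ with $\epsilon(i)\ne\epsilon(j)$ then $\kappa_p(a_1,\dots,a_k)=0$; (ii) for $p_1\in\mathcal P_{k_1},p_2\in\mathcal P_{k_2}$, $(a_1,\dots,a_{k_1})\in A_1^{k_1}$, $(a_{k_1+1},\dots,a_{k_1+k_2})\in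 A_2^{k_2}$: $\kappa_{p_1\otimes p_2}(a_1,\dots,a_{k_1+k_2})=\kappa_{p_1}(a_1,\dots,a_{k_1})\kappa_{p_2}(a_{k_1+1},\dots,a_{k_1+k_2})$. *)

theory Defs
  imports Complex_Main "HOL-Library.Disjoint_Sets" "HOL-Combinatorics.Cycles"
begin

section \<open>Partitions of two-row diagrams\<close>

text \<open>
  Columns are numbered from 0, so that they match list positions: a diagram with \<open>k\<close> columns
  has top row \<open>Top 0, \<dots>, Top (k - 1)\<close> and bottom row \<open>Bot 0, \<dots>, Bot (k - 1)\<close>.
  The constructor \<open>Mid\<close> occurs only in the three-row diagram used to define composition.
\<close>

datatype 'i vertex = Top 'i | Mid 'i | Bot 'i

type_synonym diagram = "nat vertex set set"

definition vertices :: "nat set \<Rightarrow> nat vertex set" where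
  "vertices I = Top ` I \<union> Bot ` I"

definition diagrams :: "nat \<Rightarrow> diagram set" where
  "diagrams k = {p. partition_on (vertices {..<k}) p}"

abbreviation nc :: "diagram \<Rightarrow> nat" where
  "nc p \<equiv> card p"

definition partition_join :: "'b set \<Rightarrow> 'b set set \<Rightarrow> 'b set set \<Rightarrow> 'b set set" where
  "partition_join V p q =
     (THE r. refines V p r \<and> refines V q r \<and>
             (\<forall>s. refines V p s \<and> refines V q s \<longrightarrow> refines V r s))"

abbreviation djoin :: "nat \<Rightarrow> diagram \<Rightarrow> diagram \<Rightarrow> diagram" where
  "djoin k \<equiv> partition_join (vertices {..<k})"

definition id_diagram :: "nat \<Rightarrow> diagram" where
  "id_diagram k = {{Top i, Bot i} | i. i < k}"

definition cycles :: "nat \<Rightarrow> diagram \<Rightarrow> diagram" where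
  "cycles k p = djoin k p (id_diagram k)"

definition perm_diagram :: "nat \<Rightarrow> (nat \<Rightarrow> nat) \<Rightarrow> diagram" where
  "perm_diagram k \<sigma> = {{Top i, Bot (\<sigma> i)} | i. i < k}"

definition relabel :: "(nat \<Rightarrow> nat) \<Rightarrow> diagram \<Rightarrow> diagram" where
  "relabel f p = (\<lambda>B. map_vertex f ` B) ` p"


subsection \<open>Composition, tensor product, insertion, restriction\<close>

primrec to_upper :: "'i vertex \<Rightarrow> 'i vertex" where
  "to_upper (Top i) = Top i"
| "to_upper (Bot i) = Mid i"
| "to_upper (Mid i) = Mid i"

primrec to_lower :: "'i vertex \<Rightarrow> 'i vertex" where
  "to_lower (Top i) = Mid i"
| "to_lower (Bot i) = Bot i"
| "to_lower (Mid i) = Mid i"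

text \<open>
  In \<open>dcomp k p q\<close>, which is $p \circ q$, the diagram \<open>q\<close> is placed above \<open>p\<close>. Both are
  viewed as partitions of the three rows by adding singletons in the row they do not meet.
  Blocks lying entirely in the middle row disappear.
\<close>

definition dcomp :: "nat \<Rightarrow> diagram \<Rightarrow> diagram \<Rightarrow> diagram" where
  "dcomp k p q =
     (let I = {..<k};
          upper = (\<lambda>B. to_upper ` B) ` q \<union> (\<lambda>i. {Bot i}) ` I;
          lower = (\<lambda>B. to_lower ` B) ` p \<union> (\<lambda>i. {Top i}) ` I
      in (\<lambda>B. B - range Mid) ` partition_join (Top ` I \<union> Mid ` I \<union> Bot ` I) upper lower - {{}})"

text \<open>\<open>dtensor k p q\<close> is $p \otimes q$ for \<open>p\<close> with \<open>k\<close> columns.\<close>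

definition dtensor :: "nat \<Rightarrow> diagram \<Rightarrow> diagram \<Rightarrow> diagram" where
  "dtensor k p q = p \<union> relabel (\<lambda>i. k + i) q"

definition insertion :: "nat \<Rightarrow> nat list \<Rightarrow> diagram \<Rightarrow> diagram" where
  "insertion l is p = relabel (\<lambda>j. is ! j) p \<union> {{Top i, Bot i} | i. i < l \<and> i \<notin> set is}"

definition left_part :: "nat \<Rightarrow> diagram \<Rightarrow> diagram" where
  "left_part k1 p = (\<lambda>B. B \<inter> vertices {..<k1}) ` p - {{}}"

definition right_part :: "nat \<Rightarrow> nat \<Rightarrow> diagram \<Rightarrow> diagram" where
  "right_part k1 k2 p =
     relabel (\<lambda>i. i - k1) ((\<lambda>B. B \<inter> vertices {k1..<k1 + k2}) ` p - {{}})"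


subsection \<open>Orders on partitions\<close>

definition ddist :: "nat \<Rightarrow> diagram \<Rightarrow> diagram \<Rightarrow> real" where
  "ddist k p q = (real (nc p) + real (nc q)) / 2 - real (nc (djoin k p q))"

definition geodesic_le :: "nat \<Rightarrow> diagram \<Rightarrow> diagram \<Rightarrow> bool" where
  "geodesic_le k p q \<longleftrightarrow>
     ddist k (id_diagram k) p + ddist k p q = ddist k (id_diagram k) q"

text \<open>
  \<open>coarser_compatible k q p\<close> is $q \dashv p$ and \<open>finer_compatible k q p\<close> is $q \sqsupset p$.
  The library's \<open>refines V p q\<close> says that \<open>p\<close> is finer than (or equal to) \<open>q\<close>.
\<close>

definition coarser_compatible :: "nat \<Rightarrow> diagram \<Rightarrow> diagram \<Rightarrow> bool" where
  "coarser_compatible k q p \<longleftrightarrow>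
     refines (vertices {..<k}) p q \<and> nc (cycles k q) = nc (cycles k p)"

definition finer_compatible :: "nat \<Rightarrow> diagram \<Rightarrow> diagram \<Rightarrow> bool" where
  "finer_compatible k q p \<longleftrightarrow>
     refines (vertices {..<k}) q p \<and>
     int (nc q) - int (nc (cycles k q)) = int (nc p) - int (nc (cycles k p))"


section \<open>Tracial algebras\<close>

text \<open>Algebras and sub-algebras are not required to have a unit.\<close>

locale complex_algebra = vector_space scale
  for scale :: "complex \<Rightarrow> 'a::ring \<Rightarrow> 'a" +
  assumes mult_scale_left: "scale c a * b = scale c (a * b)"
    and mult_scale_right: "a * scale c b = scale c (a * b)"

definition subalgebra :: "(complex \<Rightarrow> 'a::ring \<Rightarrow> 'a) \<Rightarrow> 'a set \<Rightarrow> bool" where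
  "subalgebra scale S \<longleftrightarrow> module.subspace scale S \<and> (\<forall>a\<in>S. \<forall>b\<in>S. a * b \<in> S)"

definition multilinear_form ::
    "(complex \<Rightarrow> 'a::ab_group_add \<Rightarrow> 'a) \<Rightarrow> nat \<Rightarrow> ('a list \<Rightarrow> complex) \<Rightarrow> bool" where
  "multilinear_form scale k f \<longleftrightarrow>
     (\<forall>xs i. length xs = k \<and> i < k \<longrightarrow> Vector_Spaces.linear scale (*) (\<lambda>a. f (xs[i := a])))"

text \<open>The product of a non-empty list; no unit is available for the empty one.\<close>

definition list_product :: "'a::semigroup_mult list \<Rightarrow> 'a" where
  "list_product xs = foldl (*) (hd xs) (tl xs)"

text \<open>
  For \<open>ns = [n\<^sub>1, \<dots>, n\<^sub>k]\<close>, \<open>offset ns j\<close> is the first position of the block number \<open>j\<close>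
  (counted from 0), and \<open>block_cycles ns\<close> is the product of the disjoint cycles
  $(1, \dots, n_1) (n_1 + 1, \dots, n_1 + n_2) \cdots$, shifted to start at 0.
\<close>

definition offset :: "nat list \<Rightarrow> nat \<Rightarrow> nat" where
  "offset ns j = sum_list (take j ns)"

definition block_cycles :: "nat list \<Rightarrow> nat \<Rightarrow> nat" where
  "block_cycles ns =
     foldr (\<circ>) (map (\<lambda>j. cycle_of_list [offset ns j..<offset ns (Suc j)]) [0..<length ns]) id"

text \<open>
  A family of forms is a function \<open>m\<close> such that, for \<open>p \<in> diagrams k\<close>, the value on
  \<open>(a\<^sub>1, \<dots>, a\<^sub>k)\<close> is \<open>m p [a\<^sub>1, \<dots>, a\<^sub>k]\<close>. The number \<open>k\<close> is determined by \<open>p\<close>, and the empty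
  partition is the unique element of \<open>diagrams 0\<close>.
\<close>

locale P_tracial_algebra = complex_algebra scale
  for scale :: "complex \<Rightarrow> 'a::ring \<Rightarrow> 'a" +
  fixes m :: "diagram \<Rightarrow> 'a list \<Rightarrow> complex"
  assumes multilinear: "p \<in> diagrams k \<Longrightarrow> multilinear_form scale k (m p)"
    and empty: "m {} [] = 1"
    and conjugation: "p \<in> diagrams k \<Longrightarrow> \<sigma> permutes {..<k} \<Longrightarrow> length as = k \<Longrightarrow>
      m p as = m (dcomp k (dcomp k (perm_diagram k \<sigma>) p) (perm_diagram k (inv \<sigma>)))
                 (map (\<lambda>i. as ! inv \<sigma> i) [0..<k])"
    and products: "p \<in> diagrams k \<Longrightarrow> length ass = k \<Longrightarrow> \<forall>as\<in>set ass. as \<noteq> [] \<Longrightarrow>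
      ns = map length ass \<Longrightarrow> n = sum_list ns \<Longrightarrow>
      m p (map list_product ass) =
        m (dcomp n (insertion n (map (offset ns) [0..<k]) p) (perm_diagram n (block_cycles ns)))
          (concat ass)"


section \<open>Exclusive moments, cumulants, freeness\<close>

text \<open>
  \<open>summation_inverse scale R m\<close> is the family \<open>f\<close> of multilinear forms determined by
  $m_p = \sum_{q \in \mathcal{P}_k,\, R_k(q, p)} f_q$. To make it unique as a total function, it
  vanishes where a form is applied to a list of the wrong length.
\<close>

definition summation_inverse ::
    "(complex \<Rightarrow> 'a::ab_group_add \<Rightarrow> 'a) \<Rightarrow> (nat \<Rightarrow> diagram \<Rightarrow> diagram \<Rightarrow> bool) \<Rightarrow>
     (diagram \<Rightarrow> 'a list \<Rightarrow> complex) \<Rightarrow> diagram \<Rightarrow> 'a list \<Rightarrow> complex" where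
  "summation_inverse scale R m =
     (THE f. (\<forall>k. \<forall>p\<in>diagrams k.
                multilinear_form scale k (f p) \<and>
                (\<forall>as. length as = k \<longrightarrow> m p as = (\<Sum>q | q \<in> diagrams k \<and> R k q p. f q as))) \<and>
             (\<forall>p as. p \<notin> diagrams (length as) \<longrightarrow> f p as = 0))"

definition exclusive_moment ::
    "(complex \<Rightarrow> 'a::ab_group_add \<Rightarrow> 'a) \<Rightarrow> (diagram \<Rightarrow> 'a list \<Rightarrow> complex) \<Rightarrow>
     diagram \<Rightarrow> 'a list \<Rightarrow> complex" where
  "exclusive_moment scale = summation_inverse scale coarser_compatible"

definition cumulant ::
    "(complex \<Rightarrow> 'a::ab_group_add \<Rightarrow> 'a) \<Rightarrow> (diagram \<Rightarrow> 'a list \<Rightarrow> complex) \<Rightarrow>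
     diagram \<Rightarrow> 'a list \<Rightarrow> complex" where
  "cumulant scale = summation_inverse scale geodesic_le"

definition P_free ::
    "(complex \<Rightarrow> 'a::ring \<Rightarrow> 'a) \<Rightarrow> (diagram \<Rightarrow> 'a list \<Rightarrow> complex) \<Rightarrow> 'a set \<Rightarrow> 'a set \<Rightarrow> bool"
  where
  "P_free scale m A1 A2 \<longleftrightarrow>
     (\<forall>k. \<forall>p\<in>diagrams k. \<forall>(\<epsilon> :: nat \<Rightarrow> bool) as.
        length as = k \<and> (\<forall>i<k. as ! i \<in> (if \<epsilon> i then A1 else A2)) \<and>
        (\<exists>C\<in>cycles k p. \<exists>i j. Top i \<in> C \<and> Top j \<in> C \<and> \<epsilon> i \<noteq> \<epsilon> j)
        \<longrightarrow> cumulant scale m p as = 0) \<and>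
     (\<forall>k1 k2. \<forall>p1\<in>diagrams k1. \<forall>p2\<in>diagrams k2. \<forall>as bs.
        length as = k1 \<and> set as \<subseteq> A1 \<and> length bs = k2 \<and> set bs \<subseteq> A2
        \<longrightarrow> cumulant scale m (dtensor k1 p1 p2) (as @ bs) =
            cumulant scale m p1 as * cumulant scale m p2 bs)"

end

theory Submission
  imports Defs
begin

text \<open>
  Write $\mathrm{c}(p)$ for the number of cycles of \<open>p\<close>. Passing from \<open>p\<close> to a coarser partition
  lowers the number of blocks at least as much as it lowers the number of cycles, because joining
  with the identity diagram can only absorb merges (\<open>card_join_submodular\<close>). In other words
  \<open>excess k p\<close>, which is $\mathrm{nc}(p) - \mathrm{c}(p)$, does not increase under coarsening.

  The first consequence is a link between the two families. Expanding the distances, $q \le p$ says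
  that $r = q \vee p$ has the excess of \<open>q\<close> and as many cycles as \<open>p\<close>. Hence $q \le p$ holds exactly
  if \<open>q \<sqsupset> r \<stileturn> p\<close> for some \<open>r\<close>, and then $r = q \vee p$ is the only choice
  (\<open>geodesic_iff_factor\<close>). Summing over \<open>r\<close> and inverting the triangular sum over \<open>\<stileturn>\<close> gives
  $m_{p^c} = \sum_{q \sqsupset p} \kappa_q$ (\<open>exclusive_moment_eq_sum_cumulant\<close>).

  The second consequence is that this sum respects tensor products. Refinements of \<open>p\<close> of the form
  $p_1 \otimes p_2$ are pairs of refinements of $p^l$ and $p^r$. The excess is additive on tensor
  products, so along $p_1 \otimes p_2$, $p^l \otimes p^r$, \<open>p\<close> it is constant exactly if
  $p_1 \sqsupset p^l$, $p_2 \sqsupset p^r$ and $p^l \otimes p^r \sqsupset p$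
  (\<open>finer_compatible_dtensor_iff\<close>). Therefore, if the cumulants of
  $(a_1, \dots, a_{k_1 + k_2})$ vanish on diagrams that are not tensor products and factor on the
  others, the sum over \<open>q \<sqsupset> p\<close> becomes the factorization of exclusive moments. Since the sum over
  \<open>\<sqsupset>\<close> is triangular, the converse holds as well (\<open>exclusive_factorization_iff\<close>).

  It remains to recognise freeness in this property of the cumulants
  (\<open>P_free_iff_cumulant_factorization\<close>). A diagram is a tensor product exactly if none of its cycles
  joins a column on the left to one on the right (\<open>splits_iff_columns\<close>, \<open>cycle_mixes_iff\<close>), which
  settles the words whose letters from \<open>A1\<close> precede those from \<open>A2\<close>. Any other word is brought to
  this form by a permutation of the columns, under which cumulants are invariant
  (\<open>cumulant_relabel\<close>).
\<close>

section \<open>Partitions as linking relations\<close>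

text \<open>
  A partition is determined by this relation, and refinement is inclusion of relations. Restricting,
  relabelling or juxtaposing diagrams is easier to follow on linked pairs than on blocks.
\<close>

definition linked :: "'b set set \<Rightarrow> 'b \<Rightarrow> 'b \<Rightarrow> bool" where
  "linked p x y \<longleftrightarrow> (\<exists>B\<in>p. x \<in> B \<and> y \<in> B)"

lemma linked_in: "partition_on V p \<Longrightarrow> linked p x y \<Longrightarrow> x \<in> V \<and> y \<in> V"
  by (auto simp: linked_def partition_on_def)

lemma partition_on_block_eq:
  "partition_on V p \<Longrightarrow> B \<in> p \<Longrightarrow> C \<in> p \<Longrightarrow> x \<in> B \<Longrightarrow> x \<in> C \<Longrightarrow> B = C"
  by (auto simp: partition_on_def disjoint_def)

lemma linked_trans: "partition_on V p \<Longrightarrow> linked p x y \<Longrightarrow> linked p y z \<Longrightarrow> linked p x z"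
  unfolding linked_def by (metis partition_on_block_eq)

lemma linked_block: "partition_on V p \<Longrightarrow> B \<in> p \<Longrightarrow> x \<in> B \<Longrightarrow> linked p x y \<longleftrightarrow> y \<in> B"
  unfolding linked_def by (metis partition_on_block_eq)

lemma refines_iff_linked:
  "refines V p q \<longleftrightarrow> partition_on V p \<and> partition_on V q \<and>
     (\<forall>x y. linked p x y \<longrightarrow> linked q x y)"
proof (intro iffI conjI allI impI)
  assume "refines V p q"
  then show "partition_on V p" "partition_on V q" by (auto simp: refines_def)
  show "linked q x y" if "linked p x y" for x y
    using that \<open>refines V p q\<close> unfolding linked_def refines_def by blast
next
  assume *: "partition_on V p \<and> partition_on V q \<and> (\<forall>x y. linked p x y \<longrightarrow> linked q x y)"
  show "refines V p q"
    unfolding refines_def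
  proof (intro conjI ballI)
    fix X assume X: "X \<in> p"
    then obtain x where x: "x \<in> X" using * by (metis partition_onD3 ex_in_conv)
    then have "linked q x x" using X * by (auto simp: linked_def)
    then obtain Y where Y: "Y \<in> q" "x \<in> Y" by (auto simp: linked_def)
    have "y \<in> Y" if "y \<in> X" for y
    proof -
      have "linked q x y" using * X x that by (auto simp: linked_def)
      then show ?thesis using Y * linked_block by metis
    qed
    then show "\<exists>Y\<in>q. X \<subseteq> Y" using Y by blast
  qed (use * in auto)
qed

lemma refinesI:
  assumes "partition_on V p" "partition_on V q" "\<And>X. X \<in> p \<Longrightarrow> \<exists>Y\<in>q. X \<subseteq> Y"
  shows "refines V p q"
  using assms by (simp add: refines_def)

lemma refines_blockE:
  assumes "refines V p q" "X \<in> p"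
  obtains Y where "Y \<in> q" "X \<subseteq> Y"
  using assms unfolding refines_def by blast

lemma partition_eqI_linked:
  assumes "partition_on V p" "partition_on V q" "\<And>x y. linked p x y \<longleftrightarrow> linked q x y"
  shows "p = q"
  using assms by (intro refines_asym[of V]) (auto simp: refines_iff_linked)

section \<open>Joins\<close>

text \<open>
  The common coarsenings of \<open>p\<close> and \<open>q\<close> form a non-empty set, and their common refinement is
  still coarser than both: it is the join.
\<close>

lemma join_properties:
  assumes p: "partition_on V p" and q: "partition_on V q"
  shows "refines V p (partition_join V p q)" (is ?a)
    and "refines V q (partition_join V p q)" (is ?b)
    and "\<And>s. refines V p s \<Longrightarrow> refines V q s \<Longrightarrow> refines V (partition_join V p q) s"
proof -
  let ?P = "{s. refines V p s \<and> refines V q s}"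
  have ne: "?P \<noteq> {}"
    \<comment> \<open>The one-block partition is a common coarsening, except on the empty set, where the block
      would be empty.\<close>
  proof (cases "V = {}")
    case True
    then have "p = {}" "q = {}" using p q by (simp_all add: partition_on_empty)
    then show ?thesis using p refines_refl by auto
  next
    case False
    then have "{V} \<in> ?P" using p q partition_on_space[OF False]
      unfolding refines_def partition_on_def by auto
    then show ?thesis by blast
  qed
  let ?r = "common_refinement ?P"
  have part: "\<And>s. s \<in> ?P \<Longrightarrow> partition_on V s" by (auto simp: refines_def)
  have r: "refines V p ?r" "refines V q ?r"
    using part p q ne by (auto intro!: common_refinement_coarsest)
  have least: "refines V ?r s" if "refines V p s" "refines V q s" for s
    using part that by (intro refines_common_refinement) auto
  have eq: "partition_join V p q = ?r"
    unfolding partition_join_def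
  proof (rule the_equality)
    fix t assume "refines V p t \<and> refines V q t \<and> (\<forall>s. refines V p s \<and> refines V q s \<longrightarrow> refines V t s)"
    then show "t = ?r" using r least by (intro refines_asym[of V]) auto
  qed (use r least in auto)
  show ?a ?b "\<And>s. refines V p s \<Longrightarrow> refines V q s \<Longrightarrow> refines V (partition_join V p q) s"
    unfolding eq by (rule r(1), rule r(2), rule least)
qed

lemma partition_on_join:
  "partition_on V p \<Longrightarrow> partition_on V q \<Longrightarrow> partition_on V (partition_join V p q)"
  using join_properties(1) refines_def by blast

lemma join_eqI:
  assumes "refines V p r" "refines V q r"
    and "\<And>s. refines V p s \<Longrightarrow> refines V q s \<Longrightarrow> refines V r s"
  shows "partition_join V p q = r"
proof -
  have pq: "partition_on V p" "partition_on V q" using assms(1,2) by (auto simp: refines_def)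
  show ?thesis
    by (rule refines_asym, rule join_properties(3)[OF pq assms(1,2)],
        rule assms(3)[OF join_properties(1,2)[OF pq]])
qed

lemma join_commute: "partition_join V p q = partition_join V q p"
  unfolding partition_join_def by (intro arg_cong[of _ _ The] ext) blast

lemma join_absorb: "refines V p q \<Longrightarrow> partition_join V p q = q"
  by (rule join_eqI) (auto simp: refines_def)

lemma join_mono_left:
  assumes "refines V p q" "partition_on V e"
  shows "refines V (partition_join V p e) (partition_join V q e)"
proof -
  have p: "partition_on V p" and q: "partition_on V q" using assms(1) by (auto simp: refines_def)
  show ?thesis
    by (rule join_properties(3)[OF p assms(2) refines_trans[OF assms(1) join_properties(1)[OF q assms(2)]]
          join_properties(2)[OF q assms(2)]])
qed

lemma partition_on_image:
  assumes "inj_on f V" "partition_on V p"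
  shows "partition_on (f ` V) ((`) f ` p)"
proof -
  have "(`) f ` p - {{}} = (`) f ` p" using partition_onD3[OF assms(2)] by auto
  then show ?thesis using partition_on_inj_image[OF assms(2,1)] by metis
qed

lemma refines_image:
  assumes "inj_on f V" "refines V p q"
  shows "refines (f ` V) ((`) f ` p) ((`) f ` q)"
  unfolding refines_def
proof (intro conjI ballI)
  fix X assume "X \<in> (`) f ` p"
  then obtain B C where "X = f ` B" "C \<in> q" "B \<subseteq> C" using assms(2) by (auto simp: refines_def)
  then show "\<exists>Y\<in>(`) f ` q. X \<subseteq> Y" by (intro bexI[of _ "f ` C"]) auto
qed (use assms partition_on_image in \<open>auto simp: refines_def\<close>)

lemma join_image:
  assumes p: "partition_on V p" and q: "partition_on V q" and f: "inj_on f V"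
  shows "partition_join (f ` V) ((`) f ` p) ((`) f ` q) = (`) f ` partition_join V p q"
proof (rule join_eqI)
  note ref = refines_image[OF f]
  show "refines (f ` V) ((`) f ` p) ((`) f ` partition_join V p q)"
    "refines (f ` V) ((`) f ` q) ((`) f ` partition_join V p q)"
    by (rule ref[OF join_properties(1)[OF p q]], rule ref[OF join_properties(2)[OF p q]])
  fix s assume s: "refines (f ` V) ((`) f ` p) s" "refines (f ` V) ((`) f ` q) s"
  let ?g = "the_inv_into V f"
  have g: "inj_on ?g (f ` V)" "?g ` f ` V = V" "\<And>x. x \<in> V \<Longrightarrow> ?g (f x) = x"
    using f by (auto simp: inj_on_the_inv_into the_inv_into_f_f)
  have refg: "refines V ((`) ?g ` a) ((`) ?g ` b)" if "refines (f ` V) a b" for a b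
    using refines_image[OF g(1) that] g(2) by simp
  have gf: "(`) ?g ` (`) f ` a = a" if "partition_on V a" for a
  proof -
    have "?g ` f ` B = B" if "B \<in> a" for B
    proof -
      have "B \<subseteq> V" using that \<open>partition_on V a\<close> by (auto simp: partition_on_def)
      then have "(\<lambda>x. ?g (f x)) ` B = (\<lambda>x. x) ` B" using g(3) by (intro image_cong) auto
      then show ?thesis by (simp add: image_image)
    qed
    then have "(\<lambda>B. ?g ` f ` B) ` a = (\<lambda>B. B) ` a" by (intro image_cong) auto
    then show ?thesis by (simp add: image_image)
  qed
  have fg: "(`) f ` (`) ?g ` a = a" if "partition_on (f ` V) a" for a
  proof -
    have "f ` ?g ` B = B" if "B \<in> a" for B
    proof -
      have "B \<subseteq> f ` V" using that \<open>partition_on (f ` V) a\<close> by (auto simp: partition_on_def)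
      then have "(\<lambda>x. f (?g x)) ` B = (\<lambda>x. x) ` B"
        using f_the_inv_into_f[OF f] by (intro image_cong) auto
      then show ?thesis by (simp add: image_image)
    qed
    then have "(\<lambda>B. f ` ?g ` B) ` a = (\<lambda>B. B) ` a" by (intro image_cong) auto
    then show ?thesis by (simp add: image_image)
  qed
  have "refines V (partition_join V p q) ((`) ?g ` s)"
    using refg[OF s(1)] refg[OF s(2)] gf[OF p] gf[OF q]
    by (intro join_properties(3)[OF p q]) simp_all
  then have "refines (f ` V) ((`) f ` partition_join V p q) ((`) f ` (`) ?g ` s)" by (rule ref)
  moreover have "partition_on (f ` V) s" using s(1) by (simp add: refines_def)
  ultimately show "refines (f ` V) ((`) f ` partition_join V p q) s" by (simp only: fg)
qed

section \<open>Block counts and submodularity\<close>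

lemma merge_partition:
  assumes p: "partition_on V p" and AB: "A \<in> p" "B \<in> p"
  shows "partition_on V (insert (A \<union> B) (p - {A, B}))"
proof (rule partition_onI)
  show "\<Union> (insert (A \<union> B) (p - {A, B})) = V" using p AB by (auto simp: partition_on_def)
  show "{} \<notin> insert (A \<union> B) (p - {A, B})" using p AB by (auto simp: partition_on_def)
  show "disjnt X Y" if "X \<in> insert (A \<union> B) (p - {A, B})" "Y \<in> insert (A \<union> B) (p - {A, B})" "X \<noteq> Y" for X Y
    using that AB partition_on_block_eq[OF p] unfolding disjnt_iff by auto
qed

lemma merge_card:
  assumes fin: "finite V" and p: "partition_on V p" and AB: "A \<in> p" "B \<in> p" "A \<noteq> B"
  shows "Suc (card (insert (A \<union> B) (p - {A, B}))) = card p"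
proof -
  have fp: "finite p" using fin p finite_elements by blast
  have "A \<union> B \<notin> p - {A, B}"
    using partition_on_block_eq[OF p] AB partition_onD3[OF p] by (metis Diff_iff Un_iff ex_in_conv insertCI)
  moreover have "card (p - {A, B}) + 2 = card p"
  proof -
    have "card {A, B} = 2" using AB by simp
    moreover have "card (p - {A, B}) = card p - card {A, B}" using AB fp by (intro card_Diff_subset) auto
    moreover have "card {A, B} \<le> card p" using AB fp by (intro card_mono) auto
    ultimately show ?thesis by linarith
  qed
  ultimately show ?thesis using fp by simp
qed

text \<open>
  Every coarsening is reached by merging two blocks at a time. This reduces inequalities between
  block counts to the effect of one merge.
\<close>

lemma refines_merge_step:
  assumes pq: "refines V p q" and ne: "p \<noteq> q"
  obtains A B where "A \<in> p" "B \<in> p" "A \<noteq> B" "refines V (insert (A \<union> B) (p - {A, B})) q"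
proof -
  have p: "partition_on V p" and q: "partition_on V q" using pq by (auto simp: refines_def)
  obtain x y where xy: "linked q x y" "\<not> linked p x y"
    using ne pq partition_eqI_linked[OF p q] by (auto simp: refines_iff_linked)
  obtain C where C: "C \<in> q" "x \<in> C" "y \<in> C" using xy by (auto simp: linked_def)
  have "x \<in> V" "y \<in> V" using linked_in[OF q xy(1)] by auto
  then obtain A B where AB: "A \<in> p" "x \<in> A" "B \<in> p" "y \<in> B"
    using p by (auto simp: partition_on_def)
  have "A \<noteq> B" using AB xy by (auto simp: linked_def)
  have sub: "X \<subseteq> C" if X: "X \<in> p" "z \<in> X" "z \<in> C" for X z
  proof -
    obtain Y where "Y \<in> q" "X \<subseteq> Y" using refines_blockE[OF pq X(1)] by blast
    then show ?thesis using partition_on_block_eq[OF q \<open>Y \<in> q\<close> C(1)] X by blast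
  qed
  have "A \<union> B \<subseteq> C" using sub AB C by blast
  have "refines V (insert (A \<union> B) (p - {A, B})) q"
    using pq C(1) \<open>A \<union> B \<subseteq> C\<close> merge_partition[OF p AB(1,3)] unfolding refines_def by blast
  then show ?thesis using that AB \<open>A \<noteq> B\<close> by blast
qed

lemma refines_merge: 
  assumes p: "partition_on V p" and AB: "A \<in> p" "B \<in> p"
  shows "refines V p (insert (A \<union> B) (p - {A, B}))"
proof (rule refinesI[OF p merge_partition[OF assms]])
  fix X assume "X \<in> p"
  then show "\<exists>Y\<in>insert (A \<union> B) (p - {A, B}). X \<subseteq> Y"
    by (cases "X \<in> {A, B}") auto
qed

lemma refines_card_le:
  assumes "finite V" "refines V p q" shows "card q \<le> card p"
  using assms(2)
proof (induction "card p" arbitrary: p rule: less_induct)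
  case less
  show ?case
  proof (cases "p = q")
    case False
    then obtain A B where AB: "A \<in> p" "B \<in> p" "A \<noteq> B" "refines V (insert (A \<union> B) (p - {A, B})) q"
      using refines_merge_step less.prems by blast
    have "Suc (card (insert (A \<union> B) (p - {A, B}))) = card p"
      using merge_card[OF assms(1)] AB less.prems by (auto simp: refines_def)
    then show ?thesis using less.hyps[OF _ AB(4)] by simp
  qed simp
qed

lemma refines_card_less:
  assumes "finite V" "refines V p q" "p \<noteq> q" shows "card q < card p"
proof -
  obtain A B where AB: "A \<in> p" "B \<in> p" "A \<noteq> B" "refines V (insert (A \<union> B) (p - {A, B})) q"
    using refines_merge_step assms by blast
  have "Suc (card (insert (A \<union> B) (p - {A, B}))) = card p"
    using merge_card[OF assms(1)] AB assms by (auto simp: refines_def)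
  then show ?thesis using refines_card_le[OF assms(1) AB(4)] by simp
qed

text \<open>
  Merging two blocks of \<open>p\<close> lowers the block count of \<open>p\<close> by one, and the block count of its
  join with \<open>e\<close> by at most one: merging the two blocks of the join that contain them already gives
  a coarsening of the merged partition and of \<open>e\<close>.
\<close>

lemma card_join_submodular:
  assumes fin: "finite V" and "refines V p q" and e: "partition_on V e"
  shows "card (partition_join V p e) + card q \<le> card (partition_join V q e) + card p"
  using assms(2)
proof (induction "card p" arbitrary: p rule: less_induct)
  case less
  show ?case
  proof (cases "p = q")
    case False
    then obtain A B where AB: "A \<in> p" "B \<in> p" "A \<noteq> B" "refines V (insert (A \<union> B) (p - {A, B})) q"
      using refines_merge_step less.prems by blast
    define p' where "p' = insert (A \<union> B) (p - {A, B})"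
    have p: "partition_on V p" using less.prems by (auto simp: refines_def)
    have p': "partition_on V p'" unfolding p'_def by (rule merge_partition[OF p AB(1,2)])
    have c: "Suc (card p') = card p"
      unfolding p'_def by (rule merge_card[OF fin p AB(1-3)])
    then have IH: "card (partition_join V p' e) + card q \<le> card (partition_join V q e) + card p'"
      using AB(4) by (intro less.hyps) (simp_all add: p'_def)
    define s where "s = partition_join V p e"
    have s: "partition_on V s" "refines V p s" "refines V e s"
      using join_properties(1,2)[OF p e] partition_on_join[OF p e] by (auto simp: s_def)
    obtain A' where A': "A' \<in> s" "A \<subseteq> A'" using refines_blockE[OF s(2) AB(1)] .
    obtain B' where B': "B' \<in> s" "B \<subseteq> B'" using refines_blockE[OF s(2) AB(2)] .
    \<comment> \<open>The blocks \<open>A'\<close> and \<open>B'\<close> may coincide, and then \<open>t\<close> is \<open>s\<close>.\<close>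
    define t where "t = insert (A' \<union> B') (s - {A', B'})"
    have t: "partition_on V t" "refines V s t"
      unfolding t_def by (rule merge_partition[OF s(1) A'(1) B'(1)], rule refines_merge[OF s(1) A'(1) B'(1)])
    have "refines V p' t"
    proof (rule refinesI[OF p' t(1)])
      fix X assume "X \<in> p'"
      then consider "X = A \<union> B" | "X \<in> p" unfolding p'_def by auto
      then show "\<exists>Y\<in>t. X \<subseteq> Y"
      proof cases
        case 1 
        then have "X \<subseteq> A' \<union> B'" using A' B' by auto
        then show ?thesis by (auto simp: t_def)
      next
        case 2
        then obtain Y where "Y \<in> t" "X \<subseteq> Y" using refines_blockE[OF refines_trans[OF s(2) t(2)]] by metis
        then show ?thesis by auto
      qed
    qed
    then have "refines V (partition_join V p' e) t"
      by (rule join_properties(3)[OF p' e _ refines_trans[OF s(3) t(2)]])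
    then have "card t \<le> card (partition_join V p' e)" by (rule refines_card_le[OF fin])
    moreover have "card s \<le> Suc (card t)"
    proof (cases "A' = B'")
      case True
      then have "t = s" using A' B' by (auto simp: t_def)
      then show ?thesis by simp
    next
      case False
      then show ?thesis using merge_card[OF fin s(1) A'(1) B'(1)] by (simp add: t_def)
    qed
    ultimately show ?thesis using IH c by (simp add: s_def)
  qed simp
qed

section \<open>Inversion of triangular sums\<close>

text \<open>
  All three relations on diagrams are reflexive and otherwise strictly increase some rank, and this
  is all that inverting a summation needs. Uniqueness is stated for plain values so that it
  applies to one fixed argument list at a time.
\<close>

lemma triangular_unique:
  fixes f g :: "'b \<Rightarrow> 'c::ab_group_add" and rank :: "'b \<Rightarrow> 'r::linorder"
  assumes fin: "finite D"
    and refl: "\<And>p. p \<in> D \<Longrightarrow> R p p"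
    and rank: "\<And>p q. p \<in> D \<Longrightarrow> q \<in> D \<Longrightarrow> R q p \<Longrightarrow> q \<noteq> p \<Longrightarrow> rank q < rank p"
    and eq: "\<And>p. p \<in> D \<Longrightarrow> (\<Sum>q | q \<in> D \<and> R q p. f q) = (\<Sum>q | q \<in> D \<and> R q p. g q)"
    and p: "p \<in> D"
  shows "f p = g p"
proof (rule ccontr)
  assume "f p \<noteq> g p"
  define S where "S = {p \<in> D. f p \<noteq> g p}"
  have S: "finite S" "S \<noteq> {}" using fin p \<open>f p \<noteq> g p\<close> by (auto simp: S_def)
  obtain r where r: "r \<in> S" "\<And>q. q \<in> S \<Longrightarrow> rank r \<le> rank q"
    using arg_min_if_finite[OF S, of rank] by (metis not_le)
  have rD: "r \<in> D" using r by (auto simp: S_def)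
  \<comment> \<open>At a disagreement of least rank all the other summands agree.\<close>
  define T where "T = {q \<in> D. R q r \<and> q \<noteq> r}"
  have split: "{q. q \<in> D \<and> R q r} = insert r T" "r \<notin> T" "finite T"
    using refl[OF rD] rD fin by (auto simp: T_def)
  have "f q = g q" if "q \<in> T" for q
  proof -
    have "rank q < rank r" using that rank[OF rD] by (auto simp: T_def)
    then have "q \<notin> S" using r(2)[of q] by auto
    then show ?thesis using that by (auto simp: S_def T_def)
  qed
  then have "sum f T = sum g T" by simp
  then have "f r = g r" using eq[OF rD] split by simp
  then show False using r(1) by (simp add: S_def)
qed

text \<open>
  The inverse is built by adding the indices in the order of their rank. The property \<open>P\<close> carries
  multilinearity along.
\<close>

lemma triangular_exists:
  fixes m :: "'b \<Rightarrow> 'x \<Rightarrow> 'c::ab_group_add" and rank :: "'b \<Rightarrow> 'r::linorder"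
  assumes fin: "finite D"
    and refl: "\<And>p. p \<in> D \<Longrightarrow> R p p"
    and rank: "\<And>p q. p \<in> D \<Longrightarrow> q \<in> D \<Longrightarrow> R q p \<Longrightarrow> q \<noteq> p \<Longrightarrow> rank q < rank p"
    and P: "\<And>p. p \<in> D \<Longrightarrow> P (m p)"
    and diff: "\<And>f g. P f \<Longrightarrow> P g \<Longrightarrow> P (\<lambda>x. f x - g x)"
  shows "\<exists>f. \<forall>p\<in>D. P (f p) \<and> (\<forall>x. m p x = (\<Sum>q | q \<in> D \<and> R q p. f q x))"
  using fin refl rank P
proof (induction D rule: finite_ranking_induct[where f = rank])
  case empty
  then show ?case by simp
next
  case (insert p D)
  show ?case
  proof (cases "p \<in> D")
    case True
    then have "insert p D = D" by auto
    then show ?thesis using insert.IH insert.prems by simp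
  next
    case False
    obtain f where f: "\<And>q. q \<in> D \<Longrightarrow> P (f q)"
      "\<And>q x. q \<in> D \<Longrightarrow> m q x = (\<Sum>r | r \<in> D \<and> R r q. f r x)"
      using insert.IH insert.prems by (metis insertCI)
    define T where "T = {q \<in> D. R q p}"
    have T: "finite T" "T \<subseteq> D" using insert.hyps by (auto simp: T_def)
    define h where "h = (\<lambda>x. m p x - (\<Sum>q\<in>T. f q x))"
    have "P (\<lambda>x. m p x - (\<Sum>q\<in>T. f q x))"
      using T
    proof (induction T rule: finite_induct)
      case empty
      then show ?case using insert.prems(3)[of p] by simp
    next
      case (insert t T)
      then have "P (\<lambda>x. (m p x - (\<Sum>q\<in>T. f q x)) - f t x)"
        using f(1)[of t] by (intro diff[of "\<lambda>x. m p x - (\<Sum>q\<in>T. f q x)"]) auto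
      then show ?case using insert.hyps by (simp add: diff_diff_eq add.commute)
    qed
    then have h: "P h" by (simp add: h_def)
    \<comment> \<open>The index \<open>p\<close> has the largest rank, so it occurs in none of the earlier sums.\<close>
    let ?g = "f(p := h)"
    have "m q x = (\<Sum>r | r \<in> insert p D \<and> R r q. ?g r x)" if q: "q \<in> insert p D" for q x
    proof (cases "q = p")
      case True
      have "{r. r \<in> insert p D \<and> R r q} = insert p T" "p \<notin> T"
        using True False insert.prems(1)[of p] by (auto simp: T_def)
      moreover have "(\<Sum>r\<in>T. ?g r x) = (\<Sum>r\<in>T. f r x)"
        using \<open>p \<notin> T\<close> by (intro sum.cong) auto
      ultimately show ?thesis using T(1) True by (simp add: h_def)
    next
      case qp: False
      then have "q \<in> D" using q by simp
      have "\<not> R p q" using insert.prems(2)[of q p] q qp insert.hyps(2)[of q] \<open>q \<in> D\<close> by auto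
      then have eq: "{r. r \<in> insert p D \<and> R r q} = {r. r \<in> D \<and> R r q}" by auto
      show ?thesis unfolding eq f(2)[OF \<open>q \<in> D\<close>] using False by (intro sum.cong) auto
    qed
    moreover have "P (?g q)" if "q \<in> insert p D" for q using that f(1) h by auto
    ultimately show ?thesis by (intro exI[of _ ?g]) blast
  qed
qed

lemma finite_diagrams: "finite (diagrams k)"
  unfolding diagrams_def by (intro finitely_many_partition_on) (simp add: vertices_def)

lemma multilinear_form_diff:
  assumes "vector_space scale" "multilinear_form scale k f" "multilinear_form scale k g"
  shows "multilinear_form scale k (\<lambda>as. f as - g as)"
proof -
  interpret vector_space_pair scale "(*) :: complex \<Rightarrow> complex \<Rightarrow> complex"
    using assms(1) by (intro vector_space_pair.intro) (simp_all add: vector_space_def algebra_simps)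
  show ?thesis using assms(2,3) unfolding multilinear_form_def by (auto intro!: linear_compose_sub)
qed

text \<open>
  The definite description in \<open>summation_inverse\<close> denotes, so that its defining equation may be used.
\<close>

lemma summation_inverse_eq:
  fixes rank :: "nat \<Rightarrow> diagram \<Rightarrow> 'r::linorder"
  assumes vs: "vector_space scale"
    and lin: "\<And>k p. p \<in> diagrams k \<Longrightarrow> multilinear_form scale k (m p)"
    and refl: "\<And>k p. p \<in> diagrams k \<Longrightarrow> R k p p"
    and rank: "\<And>k p q. p \<in> diagrams k \<Longrightarrow> q \<in> diagrams k \<Longrightarrow> R k q p \<Longrightarrow> q \<noteq> p \<Longrightarrow> rank k q < rank k p"
    and p: "p \<in> diagrams k" and as: "length as = k"
  shows "m p as = (\<Sum>q | q \<in> diagrams k \<and> R k q p. summation_inverse scale R m q as)"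
proof -
  let ?Q = "\<lambda>f. (\<forall>k. \<forall>p\<in>diagrams k. multilinear_form scale k (f p) \<and>
                (\<forall>as. length as = k \<longrightarrow> m p as = (\<Sum>q | q \<in> diagrams k \<and> R k q p. f q as))) \<and>
             (\<forall>p as. p \<notin> diagrams (length as) \<longrightarrow> f p as = 0)"
  have "\<exists>f. \<forall>p\<in>diagrams k. multilinear_form scale k (f p) \<and>
        (\<forall>as. m p as = (\<Sum>q | q \<in> diagrams k \<and> R k q p. f q as))" for k
    by (rule triangular_exists[OF finite_diagrams, where rank = "rank k"])
      (use refl rank lin multilinear_form_diff[OF vs] in auto)
  then obtain F where F: "\<And>k p. p \<in> diagrams k \<Longrightarrow> multilinear_form scale k (F k p)"
      "\<And>k p as. p \<in> diagrams k \<Longrightarrow> m p as = (\<Sum>q | q \<in> diagrams k \<and> R k q p. F k q as)"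
    by metis
  define f where "f = (\<lambda>p as. if p \<in> diagrams (length as) then F (length as) p as else 0)"
  have "multilinear_form scale k (f p)" if "p \<in> diagrams k" for k p
    using F(1)[OF that] that by (simp add: multilinear_form_def f_def)
  moreover have "m p as = (\<Sum>q | q \<in> diagrams k \<and> R k q p. f q as)"
    if "p \<in> diagrams k" "length as = k" for k p as
    unfolding F(2)[OF that(1)] using that by (intro sum.cong) (auto simp: f_def)
  ultimately have f: "?Q f" by (simp add: f_def)
  moreover have "g = f" if g: "?Q g" for g
  proof (intro ext)
    fix p as
    show "g p as = f p as"
    proof (cases "p \<in> diagrams (length as)")
      case True
      show ?thesis
      proof (rule triangular_unique[OF finite_diagrams _ _ _ True, where rank = "rank (length as)" and R = "R (length as)"])
        fix r assume "r \<in> diagrams (length as)"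
        then have "m r as = (\<Sum>q | q \<in> diagrams (length as) \<and> R (length as) q r. g q as)"
          "m r as = (\<Sum>q | q \<in> diagrams (length as) \<and> R (length as) q r. f q as)"
          using f g by auto
        then show "(\<Sum>q | q \<in> diagrams (length as) \<and> R (length as) q r. g q as) =
          (\<Sum>q | q \<in> diagrams (length as) \<and> R (length as) q r. f q as)" by simp
      qed (use refl rank in auto)
    next
      case False
      then show ?thesis using f g by auto
    qed
  qed
  ultimately have "summation_inverse scale R m = f"
    unfolding summation_inverse_def by (intro the_equality)
  then show ?thesis using f p as by simp
qed

section \<open>Exclusive moments as sums of cumulants\<close>

lemma finite_vertices: "finite (vertices {..<k})"
  by (simp add: vertices_def)

lemma diagramsD: "p \<in> diagrams k \<Longrightarrow> partition_on (vertices {..<k}) p"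
  by (simp add: diagrams_def)

lemma id_diagram_in: "id_diagram k \<in> diagrams k"
  unfolding diagrams_def id_diagram_def mem_Collect_eq
  by (rule partition_onI) (auto simp: vertices_def)

lemma djoin_in: "p \<in> diagrams k \<Longrightarrow> q \<in> diagrams k \<Longrightarrow> djoin k p q \<in> diagrams k"
  by (simp add: diagrams_def partition_on_join)

lemma cycles_in: "p \<in> diagrams k \<Longrightarrow> cycles k p \<in> diagrams k"
  by (simp add: cycles_def djoin_in id_diagram_in)

text \<open>
  The number of merges that lead from the blocks of \<open>p\<close> to its cycles. Among the refinements of
  \<open>p\<close>, the relation \<open>\<sqsupset>\<close> selects those with the same excess.
\<close>

definition excess :: "nat \<Rightarrow> diagram \<Rightarrow> int" where
  "excess k p = int (nc p) - int (nc (cycles k p))"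

lemma excess_antimono:
  assumes "refines (vertices {..<k}) q p" shows "excess k p \<le> excess k q"
  using card_join_submodular[OF finite_vertices assms diagramsD[OF id_diagram_in]]
  by (simp add: excess_def cycles_def)

lemma finer_compatible_iff:
  "finer_compatible k q p \<longleftrightarrow> refines (vertices {..<k}) q p \<and> excess k q = excess k p"
  by (simp add: finer_compatible_def excess_def)

lemma geodesic_le_iff:
  "geodesic_le k q p \<longleftrightarrow> excess k q = int (nc (djoin k q p)) - int (nc (cycles k p))"
  unfolding geodesic_le_def ddist_def excess_def cycles_def
  by (subst (1 3) join_commute) (simp add: field_simps, linarith)

lemma nc_cycles_antimono:
  assumes "refines (vertices {..<k}) q p" shows "nc (cycles k p) \<le> nc (cycles k q)"
  unfolding cycles_def
  by (rule refines_card_le[OF finite_vertices join_mono_left[OF assms diagramsD[OF id_diagram_in]]])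

text \<open>
  Put \<open>j = q \<or> p\<close>, the join. In the equation \<open>excess q = nc j - c p\<close> for $q \le p$, where \<open>c\<close>
  counts cycles, the right-hand side equals \<open>excess j - (c p - c j)\<close>. As \<open>excess j \<le> excess q\<close> and
  \<open>c j \<le> c p\<close>, both are equalities, which is \<open>q \<sqsupset> j \<stileturn> p\<close>. Conversely, if \<open>r\<close> lies between \<open>q\<close>
  and \<open>p\<close> in this way, it is coarser than \<open>j\<close> but cannot have fewer blocks.
\<close>

lemma geodesic_iff_factor:
  assumes q: "q \<in> diagrams k" and p: "p \<in> diagrams k" and r: "r \<in> diagrams k"
  shows "coarser_compatible k r p \<and> finer_compatible k q r \<longleftrightarrow>
    geodesic_le k q p \<and> r = djoin k q p"
proof -
  let ?V = "vertices {..<k}"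
  let ?j = "djoin k q p"
  note jp = join_properties[OF diagramsD[OF q] diagramsD[OF p]]
  have ej: "excess k ?j \<le> excess k q" "nc (cycles k ?j) \<le> nc (cycles k p)"
    using excess_antimono[OF jp(1)] nc_cycles_antimono[OF jp(2)] by auto
  show ?thesis
  proof
    assume "geodesic_le k q p \<and> r = ?j"
    then have g: "excess k q = int (nc ?j) - int (nc (cycles k p))" and rj: "r = ?j"
      by (auto simp: geodesic_le_iff)
    have "excess k ?j = excess k q" "nc (cycles k ?j) = nc (cycles k p)"
      using ej g unfolding excess_def by linarith+
    then show "coarser_compatible k r p \<and> finer_compatible k q r"
      unfolding rj coarser_compatible_def finer_compatible_iff using jp(1,2) by simp
  next
    assume *: "coarser_compatible k r p \<and> finer_compatible k q r"
    then have pr: "refines ?V p r" and qr: "refines ?V q r"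
      and nr: "nc (cycles k r) = nc (cycles k p)" and er: "excess k q = excess k r"
      by (auto simp: coarser_compatible_def finer_compatible_iff)
    have jr: "refines ?V ?j r" by (rule jp(3)[OF qr pr])
    have "nc r \<ge> nc ?j"
      using er ej nc_cycles_antimono[OF jr] nr excess_antimono[OF jr] unfolding excess_def by linarith
    then have "?j = r" using refines_card_less[OF finite_vertices jr] by linarith
    then show "geodesic_le k q p \<and> r = ?j"
      using er nr by (simp add: geodesic_le_iff excess_def)
  qed
qed

text \<open>The ranks that make the three summations triangular.\<close>

lemma coarser_compatible_rank:
  "coarser_compatible k q p \<Longrightarrow> q \<noteq> p \<Longrightarrow> nc q < nc p"
  unfolding coarser_compatible_def using refines_card_less[OF finite_vertices] by metis

lemma finer_compatible_rank:
  "finer_compatible k q p \<Longrightarrow> q \<noteq> p \<Longrightarrow> - int (nc q) < - int (nc p)"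
  unfolding finer_compatible_def using refines_card_less[OF finite_vertices] by (metis neg_less_iff_less of_nat_less_iff)

lemma geodesic_le_rank:
  assumes "p \<in> diagrams k" "q \<in> diagrams k" "geodesic_le k q p" "q \<noteq> p"
  shows "ddist k (id_diagram k) q < ddist k (id_diagram k) p"
proof -
  note jp = join_properties[OF diagramsD[OF assms(2)] diagramsD[OF assms(1)]]
  note le = refines_card_le[OF finite_vertices jp(1)] refines_card_le[OF finite_vertices jp(2)]
  have "djoin k q p \<noteq> q \<or> djoin k q p \<noteq> p" using assms(4) by auto
  then have "2 * nc (djoin k q p) < nc q + nc p"
    using le refines_card_less[OF finite_vertices jp(1)] refines_card_less[OF finite_vertices jp(2)]
    by fastforce
  then have "0 < ddist k q p" by (simp add: ddist_def field_simps)
  then show ?thesis using assms(3) by (simp add: geodesic_le_def)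
qed

lemma reflexive_orders:
  assumes "p \<in> diagrams k"
  shows "coarser_compatible k p p" "finer_compatible k p p" "geodesic_le k p p"
  using refines_refl[OF diagramsD[OF assms]] join_absorb[OF refines_refl[OF diagramsD[OF assms]]]
  by (simp_all add: coarser_compatible_def finer_compatible_def geodesic_le_def ddist_def)

context P_tracial_algebra begin

lemma moment_eq_sum_exclusive:
  assumes "p \<in> diagrams k" "length as = k"
  shows "m p as = (\<Sum>q | q \<in> diagrams k \<and> coarser_compatible k q p. exclusive_moment scale m q as)"
  unfolding exclusive_moment_def
  by (rule summation_inverse_eq[OF vector_space_axioms multilinear, where rank = "\<lambda>_. nc"])
    (use assms reflexive_orders coarser_compatible_rank in auto)

lemma moment_eq_sum_cumulant:
  assumes "p \<in> diagrams k" "length as = k"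
  shows "m p as = (\<Sum>q | q \<in> diagrams k \<and> geodesic_le k q p. cumulant scale m q as)"
  unfolding cumulant_def
  by (rule summation_inverse_eq[OF vector_space_axioms multilinear,
      where rank = "\<lambda>k. ddist k (id_diagram k)"])
    (use assms reflexive_orders geodesic_le_rank in auto)

text \<open>
  Both families have the same sums over \<open>\<stileturn>\<close>: for the right-hand side the double sum over
  \<open>q \<sqsupset> r \<stileturn> p\<close> meets each $q \le p$ once, with \<open>r\<close> the join of \<open>q\<close> and \<open>p\<close>.
\<close>

lemma exclusive_moment_eq_sum_cumulant:
  assumes p: "p \<in> diagrams k" and as: "length as = k"
  shows "exclusive_moment scale m p as =
    (\<Sum>q | q \<in> diagrams k \<and> finer_compatible k q p. cumulant scale m q as)"
proof (rule triangular_unique[OF finite_diagrams _ _ _ p, where rank = nc and R = "coarser_compatible k"])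
  fix p assume p: "p \<in> diagrams k"
  let ?K = "\<lambda>q. cumulant scale m q as"
  have "(\<Sum>r | r \<in> diagrams k \<and> coarser_compatible k r p.
          \<Sum>q | q \<in> diagrams k \<and> finer_compatible k q r. ?K q)
    = (\<Sum>r | r \<in> diagrams k \<and> coarser_compatible k r p.
        \<Sum>q\<in>diagrams k. if finer_compatible k q r then ?K q else 0)"
    by (simp add: sum.inter_filter finite_diagrams)
  also have "\<dots> = (\<Sum>r\<in>diagrams k. \<Sum>q\<in>diagrams k.
      if coarser_compatible k r p \<and> finer_compatible k q r then ?K q else 0)"
    by (subst sum.inter_filter[OF finite_diagrams]) (auto intro!: sum.cong)
  also have "\<dots> = (\<Sum>q\<in>diagrams k. \<Sum>r\<in>diagrams k.
      if coarser_compatible k r p \<and> finer_compatible k q r then ?K q else 0)"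
    by (rule sum.swap)
  also have "\<dots> = (\<Sum>q\<in>diagrams k. \<Sum>r\<in>diagrams k.
      if r = djoin k q p then (if geodesic_le k q p then ?K q else 0) else 0)"
    by (intro sum.cong refl) (simp add: geodesic_iff_factor p)
  also have "\<dots> = (\<Sum>q\<in>diagrams k. if geodesic_le k q p then ?K q else 0)"
    by (intro sum.cong refl) (simp add: finite_diagrams djoin_in p)
  also have "\<dots> = m p as"
    unfolding moment_eq_sum_cumulant[OF p as] by (simp add: sum.inter_filter[symmetric] finite_diagrams)
  also have "\<dots> = (\<Sum>r | r \<in> diagrams k \<and> coarser_compatible k r p. exclusive_moment scale m r as)"
    by (rule moment_eq_sum_exclusive[OF p as])
  finally show "(\<Sum>r | r \<in> diagrams k \<and> coarser_compatible k r p. exclusive_moment scale m r as)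
    = (\<Sum>r | r \<in> diagrams k \<and> coarser_compatible k r p.
          \<Sum>q | q \<in> diagrams k \<and> finer_compatible k q r. ?K q)" by simp
qed (use reflexive_orders coarser_compatible_rank in auto)

end

section \<open>Cutting a diagram in two\<close>

lemma linked_restrict:
  "linked ((\<lambda>B. B \<inter> W) ` p - {{}}) x y \<longleftrightarrow> linked p x y \<and> x \<in> W \<and> y \<in> W"
  unfolding linked_def by blast

lemma linked_image:
  "linked ((`) f ` p) x y \<longleftrightarrow> (\<exists>u v. linked p u v \<and> x = f u \<and> y = f v)"
  unfolding linked_def by blast

lemma linked_Un: "linked (p \<union> q) x y \<longleftrightarrow> linked p x y \<or> linked q x y"
  unfolding linked_def by blast

primrec column :: "'i vertex \<Rightarrow> 'i" where
  "column (Top i) = i"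
| "column (Mid i) = i"
| "column (Bot i) = i"

lemma column_map_vertex [simp]: "column (map_vertex f v) = f (column v)"
  by (cases v) auto

lemma column_in: "v \<in> vertices I \<Longrightarrow> column v \<in> I"
  by (auto simp: vertices_def)

lemma side_iff_column:
  assumes "x \<in> vertices {..<k1 + k2}"
  shows "x \<in> vertices {..<k1} \<longleftrightarrow> column x < k1"
    and "x \<in> vertices {k1..<k1 + k2} \<longleftrightarrow> \<not> column x < k1"
  using assms by (auto simp: vertices_def)

lemma inj_on_map_vertex: "inj_on f I \<Longrightarrow> inj_on (map_vertex f) (vertices I)"
  by (rule inj_onI) (auto simp: vertices_def dest: inj_onD)

lemma map_vertex_image: "map_vertex f ` vertices I = vertices (f ` I)"
  by (auto simp: vertices_def image_Un image_image)

lemma relabel_eq_image: "relabel f p = (`) (map_vertex f) ` p"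
  by (simp add: relabel_def)

lemma vertices_Un: "vertices (I \<union> J) = vertices I \<union> vertices J"
  by (auto simp: vertices_def)

lemma vertices_disjoint: "I \<inter> J = {} \<Longrightarrow> vertices I \<inter> vertices J = {}"
  by (auto simp: vertices_def)

lemma vertices_split: "vertices {..<k1 + k2} = vertices {..<k1} \<union> vertices {k1..<k1 + k2}"
  by (simp add: vertices_Un[symmetric] ivl_disj_un)

lemma shift_vertices: "map_vertex ((+) k1) ` vertices {..<k2} = vertices {k1..<k1 + k2}"
  by (simp add: map_vertex_image lessThan_atLeast0 add.commute)

lemma unshift_vertices: "map_vertex (\<lambda>i. i - k1) ` vertices {k1..<k1 + k2} = vertices {..<k2}"
  unfolding shift_vertices[symmetric] by (simp add: image_image vertex.map_comp o_def vertex.map_ident)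

lemma left_part_in:
  assumes "p \<in> diagrams (k1 + k2)" shows "left_part k1 p \<in> diagrams k1"
proof -
  have "vertices {..<k1} \<inter> vertices {..<k1 + k2} = vertices {..<k1}"
    by (auto simp: vertices_split)
  then show ?thesis
    using partition_on_restrict[OF diagramsD[OF assms], of "vertices {..<k1}"]
    by (simp add: left_part_def diagrams_def Int_commute)
qed

lemma right_part_in:
  assumes "p \<in> diagrams (k1 + k2)" shows "right_part k1 k2 p \<in> diagrams k2"
proof -
  let ?W = "vertices {k1..<k1 + k2}"
  have "?W \<inter> vertices {..<k1 + k2} = ?W"
    by (auto simp: vertices_split)
  then have "partition_on ?W ((\<lambda>B. B \<inter> ?W) ` p - {{}})"
    using partition_on_restrict[OF diagramsD[OF assms], of ?W] by (simp add: Int_commute)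
  moreover have "inj_on (map_vertex (\<lambda>i. i - k1)) ?W"
    by (intro inj_on_map_vertex) (auto simp: inj_on_def)
  ultimately show ?thesis
    unfolding right_part_def relabel_eq_image diagrams_def unshift_vertices[of k1 k2, symmetric]
    by (simp add: partition_on_image)
qed

lemma shift_part:
  "p \<in> diagrams k2 \<Longrightarrow> partition_on (vertices {k1..<k1 + k2}) (relabel ((+) k1) p)"
  unfolding shift_vertices[symmetric] relabel_eq_image
  by (intro partition_on_image inj_on_map_vertex diagramsD) auto

lemma dtensor_in:
  assumes "p1 \<in> diagrams k1" "p2 \<in> diagrams k2"
  shows "dtensor k1 p1 p2 \<in> diagrams (k1 + k2)"
proof -
  have "vertices {..<k1} \<inter> vertices {k1..<k1+k2} = {}" by (intro vertices_disjoint) auto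
  then show ?thesis
    unfolding diagrams_def dtensor_def vertices_split mem_Collect_eq
    using diagramsD[OF assms(1)] shift_part[OF assms(2), of k1] unfolding partition_on_def
    by (auto intro!: disjoint_union)
qed

lemma nc_dtensor:
  assumes "p1 \<in> diagrams k1" "p2 \<in> diagrams k2"
  shows "nc (dtensor k1 p1 p2) = nc p1 + nc p2"
proof -
  have V: "vertices {..<k1} \<inter> vertices {k1..<k1+k2} = {}" by (intro vertices_disjoint) auto
  note p1 = diagramsD[OF assms(1)] and p2 = shift_part[OF assms(2), of k1]
  have "B \<notin> relabel ((+) k1) p2" if "B \<in> p1" for B
  proof
    assume "B \<in> relabel ((+) k1) p2"
    then have "B \<subseteq> vertices {..<k1} \<inter> vertices {k1..<k1+k2}"
      using that partition_onD1[OF p1] partition_onD1[OF p2] by auto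
    then show False using V partition_onD3[OF p1] that by auto
  qed
  then have "p1 \<inter> relabel ((+) k1) p2 = {}" by auto
  moreover have "card (relabel ((+) k1) p2) = card p2"
    unfolding relabel_eq_image
    by (intro card_image inj_onI) (simp add: inj_image_eq_iff vertex.inj_map)
  ultimately show ?thesis
    unfolding dtensor_def
    using finite_elements[OF finite_vertices p1] finite_elements[OF _ p2]
    by (subst card_Un_disjoint) (simp_all add: vertices_def)
qed

lemma linked_left_part:
  "linked (left_part k1 p) x y \<longleftrightarrow> linked p x y \<and> x \<in> vertices {..<k1} \<and> y \<in> vertices {..<k1}"
  by (simp add: left_part_def linked_restrict)

lemma linked_right_part:
  "linked (right_part k1 k2 p) u v \<longleftrightarrow>
    linked p (map_vertex ((+) k1) u) (map_vertex ((+) k1) v) \<and>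
    u \<in> vertices {..<k2} \<and> v \<in> vertices {..<k2}" (is "?l \<longleftrightarrow> ?r")
proof -
  let ?s = "map_vertex ((+) k1)" and ?t = "map_vertex (\<lambda>i. i - k1)"
  have ts: "?t (?s x) = x" for x :: "nat vertex" by (simp add: vertex.map_comp o_def vertex.map_ident)
  have "?l \<longleftrightarrow> (\<exists>x y. linked p x y \<and> x \<in> ?s ` vertices {..<k2} \<and> y \<in> ?s ` vertices {..<k2} \<and>
      u = ?t x \<and> v = ?t y)"
    unfolding right_part_def relabel_eq_image linked_image linked_restrict shift_vertices by blast
  also have "\<dots> \<longleftrightarrow> ?r"
  proof
    assume ?r
    then show "\<exists>x y. linked p x y \<and> x \<in> ?s ` vertices {..<k2} \<and> y \<in> ?s ` vertices {..<k2} \<and>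
      u = ?t x \<and> v = ?t y"
      using ts by (intro exI[of _ "?s u"] exI[of _ "?s v"]) simp
  qed (auto simp: ts)
  finally show ?thesis .
qed

lemma linked_dtensor:
  "linked (dtensor k1 p1 p2) x y \<longleftrightarrow> linked p1 x y \<or>
    (\<exists>u v. linked p2 u v \<and> x = map_vertex ((+) k1) u \<and> y = map_vertex ((+) k1) v)"
  by (simp add: dtensor_def linked_Un relabel_eq_image linked_image)

text \<open>
  Cutting is right adjoint to the tensor product with respect to refinement. In particular the tensor
  product of the two parts of \<open>p\<close> is the coarsest tensor product that refines \<open>p\<close>.
\<close>

lemma dtensor_refines_iff:
  assumes p1: "p1 \<in> diagrams k1" and p2: "p2 \<in> diagrams k2" and p: "p \<in> diagrams (k1 + k2)"
  shows "refines (vertices {..<k1 + k2}) (dtensor k1 p1 p2) p \<longleftrightarrow>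
    refines (vertices {..<k1}) p1 (left_part k1 p) \<and>
    refines (vertices {..<k2}) p2 (right_part k1 k2 p)"
  unfolding refines_iff_linked linked_left_part linked_right_part linked_dtensor
  using diagramsD[OF p1] diagramsD[OF p2] diagramsD[OF p] diagramsD[OF dtensor_in[OF p1 p2]]
    diagramsD[OF left_part_in[OF p]] diagramsD[OF right_part_in[OF p]]
    linked_in[OF diagramsD[OF p1]] linked_in[OF diagramsD[OF p2]]
  by blast

lemma shift_notin: "map_vertex ((+) k1) u \<notin> vertices {..<k1}"
  using column_in[of "map_vertex ((+) k1) u" "{..<k1}"] by auto

lemma left_part_dtensor:
  assumes p1: "p1 \<in> diagrams k1" and p2: "p2 \<in> diagrams k2"
  shows "left_part k1 (dtensor k1 p1 p2) = p1"
proof (rule partition_eqI_linked[OF diagramsD[OF left_part_in[OF dtensor_in[OF assms]]] diagramsD[OF p1]])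
  fix x y
  show "linked (left_part k1 (dtensor k1 p1 p2)) x y \<longleftrightarrow> linked p1 x y"
    using linked_in[OF diagramsD[OF p1]] shift_notin by (auto simp: linked_left_part linked_dtensor)
qed

lemma right_part_dtensor:
  assumes p1: "p1 \<in> diagrams k1" and p2: "p2 \<in> diagrams k2"
  shows "right_part k1 k2 (dtensor k1 p1 p2) = p2"
proof (rule partition_eqI_linked[OF diagramsD[OF right_part_in[OF dtensor_in[OF assms]]] diagramsD[OF p2]])
  fix x y
  have inj: "map_vertex ((+) k1) u = map_vertex ((+) k1) v \<longleftrightarrow> u = v" for u v :: "nat vertex"
    using vertex.inj_map[of "(+) k1"] by (auto simp: inj_eq)
  show "linked (right_part k1 k2 (dtensor k1 p1 p2)) x y \<longleftrightarrow> linked p2 x y"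
  proof -
    have "\<not> linked p1 (map_vertex ((+) k1) u) v" for u v
      using linked_in[OF diagramsD[OF p1]] shift_notin by blast
    then show ?thesis
      using linked_in[OF diagramsD[OF p2]] by (auto simp: linked_right_part linked_dtensor inj)
  qed
qed

lemma dtensor_parts_refines:
  assumes "p \<in> diagrams (k1 + k2)"
  shows "refines (vertices {..<k1 + k2}) (dtensor k1 (left_part k1 p) (right_part k1 k2 p)) p"
  using assms refines_refl diagramsD left_part_in right_part_in by (subst dtensor_refines_iff) blast+

lemma id_diagram_eq_image: "id_diagram k = (\<lambda>i. {Top i, Bot i}) ` {..<k}"
  by (auto simp: id_diagram_def)

lemma id_diagram_dtensor: "id_diagram (k1 + k2) = dtensor k1 (id_diagram k1) (id_diagram k2)"
proof -
  have "{..<k1 + k2} = {..<k1} \<union> (+) k1 ` {..<k2}"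
    by (simp add: lessThan_atLeast0 add.commute ivl_disj_un)
  then show ?thesis
    by (simp add: id_diagram_eq_image dtensor_def relabel_eq_image image_Un image_image)
qed

text \<open>
  The identity diagram is itself a tensor product, so the adjunction compares the upper bounds of
  both sides part by part.
\<close>

lemma cycles_dtensor:
  assumes p1: "p1 \<in> diagrams k1" and p2: "p2 \<in> diagrams k2"
  shows "cycles (k1 + k2) (dtensor k1 p1 p2) = dtensor k1 (cycles k1 p1) (cycles k2 p2)"
proof -
  note i1 = id_diagram_in[of k1] and i2 = id_diagram_in[of k2]
  note c1 = cycles_in[OF p1] and c2 = cycles_in[OF p2]
  note j1 = join_properties[OF diagramsD[OF p1] diagramsD[OF i1], folded cycles_def]
  note j2 = join_properties[OF diagramsD[OF p2] diagramsD[OF i2], folded cycles_def]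
  note c12 = dtensor_in[OF c1 c2]
  show ?thesis
    unfolding cycles_def[of "k1 + k2"] id_diagram_dtensor
  proof (rule join_eqI)
    fix s
    assume s: "refines (vertices {..<k1 + k2}) (dtensor k1 p1 p2) s"
      "refines (vertices {..<k1 + k2}) (dtensor k1 (id_diagram k1) (id_diagram k2)) s"
    then have sD: "s \<in> diagrams (k1 + k2)" by (auto simp: diagrams_def refines_def)
    show "refines (vertices {..<k1 + k2}) (dtensor k1 (cycles k1 p1) (cycles k2 p2)) s"
      using s unfolding dtensor_refines_iff[OF p1 p2 sD] dtensor_refines_iff[OF i1 i2 sD]
        dtensor_refines_iff[OF c1 c2 sD]
      using j1(3) j2(3) by simp
  qed (simp_all add: dtensor_refines_iff[OF p1 p2 c12] dtensor_refines_iff[OF i1 i2 c12]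
        left_part_dtensor[OF c1 c2] right_part_dtensor[OF c1 c2] j1(1,2) j2(1,2))
qed

lemma excess_dtensor:
  assumes p1: "p1 \<in> diagrams k1" and p2: "p2 \<in> diagrams k2"
  shows "excess (k1 + k2) (dtensor k1 p1 p2) = excess k1 p1 + excess k2 p2"
  by (simp add: excess_def cycles_dtensor[OF assms] nc_dtensor[OF assms]
      nc_dtensor[OF cycles_in[OF p1] cycles_in[OF p2]])

text \<open>
  The three excesses of $p_1 \otimes p_2$, $p^l \otimes p^r$ and \<open>p\<close> decrease along this chain of
  refinements, and so do the excesses of the two components in its first step. The outer two agree
  only if all inequalities on the way are equalities.
\<close>

lemma finer_compatible_dtensor_iff:
  assumes p1: "p1 \<in> diagrams k1" and p2: "p2 \<in> diagrams k2" and p: "p \<in> diagrams (k1 + k2)"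
  shows "finer_compatible (k1 + k2) (dtensor k1 p1 p2) p \<longleftrightarrow>
    finer_compatible (k1 + k2) (dtensor k1 (left_part k1 p) (right_part k1 k2 p)) p \<and>
    finer_compatible k1 p1 (left_part k1 p) \<and> finer_compatible k2 p2 (right_part k1 k2 p)"
proof (cases "refines (vertices {..<k1}) p1 (left_part k1 p) \<and>
    refines (vertices {..<k2}) p2 (right_part k1 k2 p)")
  case True
  note e1 = excess_antimono[OF conjunct1[OF True]] and e2 = excess_antimono[OF conjunct2[OF True]]
  note e = excess_antimono[OF dtensor_parts_refines[OF p]]
  show ?thesis
    using True e1 e2 e dtensor_parts_refines[OF p]
    unfolding finer_compatible_iff dtensor_refines_iff[OF p1 p2 p]
      excess_dtensor[OF p1 p2] excess_dtensor[OF left_part_in[OF p] right_part_in[OF p]]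
    by auto
next
  case False
  then show ?thesis
    unfolding finer_compatible_iff dtensor_refines_iff[OF p1 p2 p] by blast
qed

definition splits :: "nat \<Rightarrow> nat \<Rightarrow> diagram \<Rightarrow> bool" where
  "splits k1 k2 p \<longleftrightarrow> p = dtensor k1 (left_part k1 p) (right_part k1 k2 p)"

lemma splits_dtensor:
  assumes "p1 \<in> diagrams k1" "p2 \<in> diagrams k2"
  shows "splits k1 k2 (dtensor k1 p1 p2)"
  by (simp add: splits_def left_part_dtensor[OF assms] right_part_dtensor[OF assms])

text \<open>
  The tensor products \<open>q \<sqsupset> p\<close> are the pairs of diagrams below the two parts of \<open>p\<close>, if the parts
  themselves recombine to a diagram \<open>\<sqsupset> p\<close>, and there are none otherwise. A function that factors
  over the two components therefore has a sum that factors.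
\<close>

lemma sum_splits:
  fixes F G :: "diagram \<Rightarrow> 'c::comm_semiring_1"
  assumes p: "p \<in> diagrams (k1 + k2)"
  shows "(\<Sum>q | q \<in> diagrams (k1 + k2) \<and> finer_compatible (k1 + k2) q p.
      of_bool (splits k1 k2 q) * (F (left_part k1 q) * G (right_part k1 k2 q))) =
    of_bool (finer_compatible (k1 + k2) (dtensor k1 (left_part k1 p) (right_part k1 k2 p)) p) *
    ((\<Sum>q | q \<in> diagrams k1 \<and> finer_compatible k1 q (left_part k1 p). F q) *
    (\<Sum>q | q \<in> diagrams k2 \<and> finer_compatible k2 q (right_part k1 k2 p). G q))"
proof -
  let ?Q = "{q. q \<in> diagrams (k1 + k2) \<and> finer_compatible (k1 + k2) q p}"
  let ?Q1 = "{q. q \<in> diagrams k1 \<and> finer_compatible k1 q (left_part k1 p)}"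
  let ?Q2 = "{q. q \<in> diagrams k2 \<and> finer_compatible k2 q (right_part k1 k2 p)}"
  let ?c = "finer_compatible (k1 + k2) (dtensor k1 (left_part k1 p) (right_part k1 k2 p)) p"
  have lhs: "(\<Sum>q\<in>?Q. of_bool (splits k1 k2 q) * (F (left_part k1 q) * G (right_part k1 k2 q))) =
    (\<Sum>q\<in>{q\<in>?Q. splits k1 k2 q}. F (left_part k1 q) * G (right_part k1 k2 q))"
    by (rule sum.mono_neutral_cong_right) (auto simp: finite_diagrams)
  have split: "q \<in> ?Q \<and> splits k1 k2 q \<longleftrightarrow> ?c \<and> (\<exists>q1\<in>?Q1. \<exists>q2\<in>?Q2. q = dtensor k1 q1 q2)" for q
  proof
    assume q: "q \<in> ?Q \<and> splits k1 k2 q"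
    then have qD: "q \<in> diagrams (k1 + k2)" by blast
    note l = left_part_in[OF qD] and r = right_part_in[OF qD]
    have eq: "q = dtensor k1 (left_part k1 q) (right_part k1 k2 q)"
      using q by (simp add: splits_def)
    have "finer_compatible (k1 + k2) (dtensor k1 (left_part k1 q) (right_part k1 k2 q)) p"
      using q eq by simp
    then show "?c \<and> (\<exists>q1\<in>?Q1. \<exists>q2\<in>?Q2. q = dtensor k1 q1 q2)"
      unfolding finer_compatible_dtensor_iff[OF l r p] using l r eq by blast
  next
    assume "?c \<and> (\<exists>q1\<in>?Q1. \<exists>q2\<in>?Q2. q = dtensor k1 q1 q2)"
    then show "q \<in> ?Q \<and> splits k1 k2 q"
      using finer_compatible_dtensor_iff[OF _ _ p] splits_dtensor dtensor_in by blast
  qed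
  show ?thesis
  proof (cases ?c)
    case False
    then have "{q\<in>?Q. splits k1 k2 q} = {}" using split by blast
    then show ?thesis unfolding lhs using False by (simp only:) simp
  next
    case True
    have "(\<Sum>q\<in>{q\<in>?Q. splits k1 k2 q}. F (left_part k1 q) * G (right_part k1 k2 q)) =
      (\<Sum>(q1, q2)\<in>?Q1 \<times> ?Q2. F q1 * G q2)"
    proof (rule sum.reindex_bij_witness[where i = "\<lambda>(q1, q2). dtensor k1 q1 q2"
          and j = "\<lambda>q. (left_part k1 q, right_part k1 k2 q)"])
      fix q assume "q \<in> {q\<in>?Q. splits k1 k2 q}"
      then obtain q1 q2 where q: "q1 \<in> ?Q1" "q2 \<in> ?Q2" "q = dtensor k1 q1 q2" using split by blast
      then have "left_part k1 q = q1" "right_part k1 k2 q = q2"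
        using left_part_dtensor[of q1 k1 q2 k2] right_part_dtensor[of q1 k1 q2 k2] by simp_all
      then show "(\<lambda>(q1, q2). dtensor k1 q1 q2) (left_part k1 q, right_part k1 k2 q) = q"
        "(left_part k1 q, right_part k1 k2 q) \<in> ?Q1 \<times> ?Q2"
        using q by simp_all
    next
      fix b assume "b \<in> ?Q1 \<times> ?Q2"
      then obtain q1 q2 where q: "q1 \<in> ?Q1" "q2 \<in> ?Q2" "b = (q1, q2)" by blast
      then show "(left_part k1 ((\<lambda>(q1, q2). dtensor k1 q1 q2) b),
          right_part k1 k2 ((\<lambda>(q1, q2). dtensor k1 q1 q2) b)) = b"
        using left_part_dtensor[of q1 k1 q2 k2] right_part_dtensor[of q1 k1 q2 k2] by simp
      have "dtensor k1 q1 q2 \<in> ?Q \<and> splits k1 k2 (dtensor k1 q1 q2)"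
        by (rule iffD2[OF split]) (use True q(1,2) in blast)
      then show "(\<lambda>(q1, q2). dtensor k1 q1 q2) b \<in> {q\<in>?Q. splits k1 k2 q}"
        using q(3) by simp
    qed auto
    then show ?thesis unfolding lhs using True by (simp add: sum_product sum.cartesian_product)
  qed
qed

lemma splits_iff_columns:
  assumes p: "p \<in> diagrams (k1 + k2)"
  shows "splits k1 k2 p \<longleftrightarrow> (\<forall>x y. linked p x y \<longrightarrow> (column x < k1 \<longleftrightarrow> column y < k1))"
proof
  assume "splits k1 k2 p"
  then have eq: "p = dtensor k1 (left_part k1 p) (right_part k1 k2 p)" by (simp add: splits_def)
  show "\<forall>x y. linked p x y \<longrightarrow> (column x < k1 \<longleftrightarrow> column y < k1)"
  proof (intro allI impI)
    fix x y assume "linked p x y"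
    then have "linked (dtensor k1 (left_part k1 p) (right_part k1 k2 p)) x y" using eq by simp
    then show "column x < k1 \<longleftrightarrow> column y < k1"
      unfolding linked_dtensor linked_left_part by (auto dest!: column_in)
  qed
next
  assume *: "\<forall>x y. linked p x y \<longrightarrow> (column x < k1 \<longleftrightarrow> column y < k1)"
  show "splits k1 k2 p"
    unfolding splits_def
  proof (rule partition_eqI_linked[OF diagramsD[OF p] diagramsD[OF dtensor_in[OF left_part_in right_part_in]]], rule p, rule p)
    fix x y
    show "linked p x y \<longleftrightarrow> linked (dtensor k1 (left_part k1 p) (right_part k1 k2 p)) x y"
    proof
      assume "linked (dtensor k1 (left_part k1 p) (right_part k1 k2 p)) x y"
      then show "linked p x y" unfolding linked_dtensor linked_left_part linked_right_part by auto
    next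
      assume xy: "linked p x y"
      have V: "x \<in> vertices {..<k1 + k2}" "y \<in> vertices {..<k1 + k2}"
        using linked_in[OF diagramsD[OF p] xy] by auto
      show "linked (dtensor k1 (left_part k1 p) (right_part k1 k2 p)) x y"
      proof (cases "column x < k1")
        case True
        then have "x \<in> vertices {..<k1}" "y \<in> vertices {..<k1}"
          using * xy side_iff_column[OF V(1)] side_iff_column[OF V(2)] by simp_all
        then show ?thesis using xy by (simp add: linked_dtensor linked_left_part)
      next
        case False
        then have "x \<in> map_vertex ((+) k1) ` vertices {..<k2}" "y \<in> map_vertex ((+) k1) ` vertices {..<k2}"
          using * xy side_iff_column[OF V(1)] side_iff_column[OF V(2)]
          unfolding shift_vertices by simp_all
        then obtain u v where "u \<in> vertices {..<k2}" "v \<in> vertices {..<k2}"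
          "x = map_vertex ((+) k1) u" "y = map_vertex ((+) k1) v" by blast
        then show ?thesis using xy by (auto simp: linked_dtensor linked_right_part)
      qed
    qed
  qed
qed

lemma partition_on_kernel: "partition_on V ((\<lambda>x. {y \<in> V. h y = h x}) ` V)"
  by (rule partition_onI) (auto simp: disjnt_def)

lemma linked_kernel: "linked ((\<lambda>x. {y \<in> V. h y = h x}) ` V) x y \<longleftrightarrow> x \<in> V \<and> y \<in> V \<and> h x = h y"
  unfolding linked_def by auto

lemma linked_id_diagram:
  "linked (id_diagram k) x y \<longleftrightarrow> x \<in> vertices {..<k} \<and> y \<in> vertices {..<k} \<and> column x = column y"
  unfolding id_diagram_eq_image linked_def vertices_def by auto

text \<open>
  Columns of the same colour form a partition that is coarser than the identity diagram. It is coarser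
  than the cycles of \<open>p\<close> as soon as it is coarser than \<open>p\<close>. In the other direction, every point
  lies in the same cycle as the top point of its column.
\<close>

lemma cycle_mixes_iff:
  fixes \<epsilon> :: "nat \<Rightarrow> 'c"
  assumes p: "p \<in> diagrams k"
  shows "(\<exists>C\<in>cycles k p. \<exists>i j. Top i \<in> C \<and> Top j \<in> C \<and> \<epsilon> i \<noteq> \<epsilon> j) \<longleftrightarrow>
    (\<exists>x y. linked p x y \<and> \<epsilon> (column x) \<noteq> \<epsilon> (column y))"
proof -
  let ?V = "vertices {..<k}"
  note j = join_properties[OF diagramsD[OF p] diagramsD[OF id_diagram_in], folded cycles_def]
  have "(\<exists>C\<in>cycles k p. \<exists>i j. Top i \<in> C \<and> Top j \<in> C \<and> \<epsilon> i \<noteq> \<epsilon> j) \<longleftrightarrow>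
    (\<exists>i j. linked (cycles k p) (Top i) (Top j) \<and> \<epsilon> i \<noteq> \<epsilon> j)"
    unfolding linked_def by blast
  also have "\<dots> \<longleftrightarrow> (\<exists>x y. linked p x y \<and> \<epsilon> (column x) \<noteq> \<epsilon> (column y))" (is "?l \<longleftrightarrow> ?r")
  proof
    assume ?l
    show ?r
    proof (rule ccontr)
      assume neg: "\<not> ?r"
      let ?s = "(\<lambda>x. {y \<in> ?V. \<epsilon> (column y) = \<epsilon> (column x)}) ` ?V"
      have "refines ?V p ?s" "refines ?V (id_diagram k) ?s"
        unfolding refines_iff_linked linked_kernel
        using neg linked_in[OF diagramsD[OF p]] diagramsD[OF p] diagramsD[OF id_diagram_in]
        by (auto simp: partition_on_kernel linked_id_diagram)
      then have "refines ?V (cycles k p) ?s" by (rule j(3))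
      then have "\<epsilon> (column x) = \<epsilon> (column y)" if "linked (cycles k p) x y" for x y
        using that unfolding refines_iff_linked linked_kernel by blast
      then show False using \<open>?l\<close> by fastforce
    qed
  next
    assume ?r
    then obtain x y where xy: "linked p x y" "\<epsilon> (column x) \<noteq> \<epsilon> (column y)" by blast
    let ?c = "linked (cycles k p)"
    have V: "x \<in> ?V" "y \<in> ?V" using linked_in[OF diagramsD[OF p] xy(1)] by auto
    have top: "Top (column z) \<in> ?V" if "z \<in> ?V" for z :: "nat vertex"
      using column_in[OF that] by (auto simp: vertices_def)
    have "?c x y" "?c (Top (column x)) x" "?c y (Top (column y))"
      using j(1,2) xy(1) V top unfolding refines_iff_linked by (simp_all add: linked_id_diagram)
    then have "?c (Top (column x)) (Top (column y))"
      by (metis linked_trans[OF diagramsD[OF cycles_in[OF p]]])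
    then show ?l using xy(2) by blast
  qed
  finally show ?thesis .
qed

section \<open>Conjugation by a permutation\<close>

text \<open>
  Composing with a permutation diagram needs one explicit join. Replace each point \<open>v\<close> of \<open>V\<close> by a
  set \<open>g v\<close> with a marked point \<open>\<iota> v\<close>. The diagram \<open>p\<close> placed on the marked points, joined with the
  partition into the sets \<open>g v\<close>, is \<open>p\<close> with each block blown up. In the compositions below, the sets
  \<open>g v\<close> are the blocks of the permutation diagram, completed by singletons in the row it does not meet.
\<close>

lemma join_blow_up:
  assumes p: "partition_on V p" and g: "disjoint_family_on g V"
    and \<iota>: "\<And>v. v \<in> V \<Longrightarrow> \<iota> v \<in> g v" and W: "W = (\<Union>v\<in>V. g v)"
  shows "partition_join W ((`) \<iota> ` p \<union> (\<lambda>w. {w}) ` (W - \<iota> ` V)) (g ` V) = (\<lambda>B. \<Union>v\<in>B. g v) ` p"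
    (is "partition_join W ?U _ = ?r")
proof (rule join_eqI)
  have geq: "u = v" if "x \<in> g u" "x \<in> g v" "u \<in> V" "v \<in> V" for x u v
    using g that unfolding disjoint_family_on_def by blast
  have inj: "inj_on \<iota> V" using geq \<iota> by (intro inj_onI) metis
  have U: "partition_on W ?U"
  proof -
    have 1: "partition_on (\<iota> ` V) ((`) \<iota> ` p)" using inj p by (rule partition_on_image)
    have 2: "partition_on (W - \<iota> ` V) ((\<lambda>w. {w}) ` (W - \<iota> ` V))" by (rule partition_on_singletons)
    have 3: "\<iota> ` V \<union> (W - \<iota> ` V) = W" using \<iota> W by blast
    have "\<Union> ?U = W" using partition_onD1[OF 1] partition_onD1[OF 2] 3 by (metis Union_Un_distrib)
    moreover have "disjoint ?U"
      using partition_onD2[OF 1] partition_onD2[OF 2] partition_onD1[OF 1] partition_onD1[OF 2]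
      by (intro disjoint_union) auto
    ultimately show ?thesis using partition_onD3[OF 1] by (auto simp: partition_on_def)
  qed
  have G: "partition_on W (g ` V)"
  proof (rule partition_onI)
    show "\<Union> (g ` V) = W" using W by simp
    show "{} \<notin> g ` V" using \<iota> by blast
    show "disjnt a b" if ab: "a \<in> g ` V" "b \<in> g ` V" "a \<noteq> b" for a b
      using ab geq unfolding disjnt_iff by blast
  qed
  have R: "partition_on W ?r"
  proof (rule partition_onI)
    have "(\<Union>B\<in>p. \<Union>v\<in>B. g v) = (\<Union>v\<in>\<Union>p. g v)" by blast
    then show "\<Union> ?r = W" using W partition_onD1[OF p] by simp
    show "{} \<notin> ?r"
    proof
      assume "{} \<in> ?r"
      then obtain B where B: "B \<in> p" "(\<Union>v\<in>B. g v) = {}" by blast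
      then obtain v where "v \<in> B" using partition_onD3[OF p] by (metis ex_in_conv)
      then have "v \<in> V" using B partition_onD1[OF p] by blast
      then show False using \<iota>[of v] B(2) \<open>v \<in> B\<close> by blast
    qed
    fix a b assume ab: "a \<in> ?r" "b \<in> ?r" "a \<noteq> b"
    then obtain B C where BC: "B \<in> p" "C \<in> p" "a = (\<Union>v\<in>B. g v)" "b = (\<Union>v\<in>C. g v)" by blast
    show "disjnt a b"
      unfolding disjnt_iff
    proof (intro allI notI)
      fix x assume "x \<in> a \<and> x \<in> b"
      then obtain u v where uv: "u \<in> B" "v \<in> C" "x \<in> g u" "x \<in> g v" using BC by blast
      then have "u \<in> V" "v \<in> V" using BC partition_onD1[OF p] by auto
      then have "u = v" using geq uv by blast
      then have "B = C" using partition_on_block_eq[OF p BC(1,2)] uv by blast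
      then show False using ab(3) BC by simp
    qed
  qed
  show "refines W ?U ?r"
  proof (rule refinesI[OF U R])
    fix X assume "X \<in> ?U"
    then consider B where "B \<in> p" "X = \<iota> ` B" | w where "w \<in> W" "X = {w}" by blast
    then show "\<exists>Y\<in>?r. X \<subseteq> Y"
    proof cases
      case 1
      then have "X \<subseteq> (\<Union>v\<in>B. g v)" using \<iota> partition_onD1[OF p] by blast
      then show ?thesis using 1 by blast
    next
      case 2
      then show ?thesis using partition_onD1[OF R] by blast
    qed
  qed
  show "refines W (g ` V) ?r"
  proof (rule refinesI[OF G R])
    fix X assume "X \<in> g ` V"
    then obtain v where "v \<in> V" "X = g v" by blast
    moreover then obtain B where "B \<in> p" "v \<in> B" using partition_onD1[OF p] by blast
    ultimately show "\<exists>Y\<in>?r. X \<subseteq> Y" by blast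
  qed
  fix s assume s: "refines W ?U s" "refines W (g ` V) s"
  then have sW: "partition_on W s" by (auto simp: refines_def)
  show "refines W ?r s"
    unfolding refines_iff_linked
  proof (intro conjI allI impI)
    fix x y assume "linked ?r x y"
    then obtain B u v where B: "B \<in> p" "u \<in> B" "v \<in> B" "x \<in> g u" "y \<in> g v"
      unfolding linked_def by blast
    then have V: "u \<in> V" "v \<in> V" using partition_onD1[OF p] by auto
    have "linked (g ` V) x (\<iota> u)" "linked (g ` V) (\<iota> v) y" "linked ?U (\<iota> u) (\<iota> v)"
      using B V \<iota> unfolding linked_def by blast+
    then have "linked s x (\<iota> u)" "linked s (\<iota> v) y" "linked s (\<iota> u) (\<iota> v)"
      using s unfolding refines_iff_linked by blast+
    then show "linked s x y" by (metis linked_trans[OF sW])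
  qed (rule R, rule sW)
qed

text \<open>
  If each \<open>g v\<close> has exactly one point \<open>h v\<close> outside the middle row, erasing that row replaces \<open>v\<close>
  by \<open>h v\<close>, and no block becomes empty.
\<close>

lemma erase_middle:
  assumes p: "partition_on V p" and g: "\<And>v. v \<in> V \<Longrightarrow> g v - range Mid = {h v}"
  shows "(\<lambda>B. B - range Mid) ` (\<lambda>B. \<Union>v\<in>B. g v) ` p - {{}} = (`) h ` p"
proof -
  have eq: "(\<Union>v\<in>B. g v) - range Mid = h ` B" if "B \<in> p" for B
  proof -
    have "(\<Union>v\<in>B. g v) - range Mid = (\<Union>v\<in>B. g v - range Mid)" by blast
    also have "\<dots> = (\<Union>v\<in>B. {h v})" using g that partition_onD1[OF p] by (intro SUP_cong) auto
    finally show ?thesis by blast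
  qed
  have "(\<lambda>B. B - range Mid) ` (\<lambda>B. \<Union>v\<in>B. g v) ` p = (`) h ` p"
    unfolding image_image by (intro image_cong eq) auto
  moreover have "{} \<notin> (`) h ` p" using partition_onD3[OF p] by auto
  ultimately show ?thesis by simp
qed

primrec map_top :: "(nat \<Rightarrow> nat) \<Rightarrow> nat vertex \<Rightarrow> nat vertex" where
  "map_top f (Top i) = Top (f i)"
| "map_top f (Mid i) = Mid i"
| "map_top f (Bot i) = Bot i"

primrec map_bot :: "(nat \<Rightarrow> nat) \<Rightarrow> nat vertex \<Rightarrow> nat vertex" where
  "map_bot f (Top i) = Top i"
| "map_bot f (Mid i) = Mid i"
| "map_bot f (Bot i) = Bot (f i)"

lemma perm_diagram_eq_image: "perm_diagram k \<sigma> = (\<lambda>i. {Top i, Bot (\<sigma> i)}) ` {..<k}"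
  by (auto simp: perm_diagram_def)

lemma dcomp_perm_left:
  assumes p: "p \<in> diagrams k" and \<sigma>: "\<sigma> permutes {..<k}"
  shows "dcomp k (perm_diagram k \<sigma>) p = (`) (map_bot \<sigma>) ` p"
proof -
  let ?I = "{..<k}" and ?V = "vertices {..<k}"
  define W :: "nat vertex set" where "W = Top ` ?I \<union> Mid ` ?I \<union> Bot ` ?I"
  define g :: "nat vertex \<Rightarrow> nat vertex set" where
    "g = (\<lambda>v. case v of Top i \<Rightarrow> {Top i} | Mid i \<Rightarrow> {} | Bot i \<Rightarrow> {Mid i, Bot (\<sigma> i)})"
  note inj = permutes_inj_on[OF \<sigma>, of ?I] and im = permutes_image[OF \<sigma>]
  have gV: "g ` ?V = (\<lambda>i. {Top i}) ` ?I \<union> (\<lambda>i. {Mid i, Bot (\<sigma> i)}) ` ?I"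
    by (simp add: g_def vertices_def image_Un image_image)
  have UgV: "(\<Union>v\<in>?V. g v) = Top ` ?I \<union> (Mid ` ?I \<union> Bot ` \<sigma> ` ?I)"
    by (auto simp: g_def vertices_def)
  have upper: "(\<lambda>i. {Bot i}) ` ?I = (\<lambda>w. {w}) ` (W - to_upper ` ?V)"
  proof -
    have "W - to_upper ` ?V = Bot ` ?I" by (auto simp: W_def vertices_def image_Un image_image)
    then show ?thesis by (simp add: image_image)
  qed
  have lower: "(\<lambda>B. to_lower ` B) ` perm_diagram k \<sigma> \<union> (\<lambda>i. {Top i}) ` ?I = g ` ?V"
    unfolding gV perm_diagram_eq_image by (simp add: image_image Un_commute)
  have "partition_join W ((\<lambda>B. to_upper ` B) ` p \<union> (\<lambda>i. {Bot i}) ` ?I)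
      ((\<lambda>B. to_lower ` B) ` perm_diagram k \<sigma> \<union> (\<lambda>i. {Top i}) ` ?I) = (\<lambda>B. \<Union>v\<in>B. g v) ` p"
    unfolding upper lower
  proof (rule join_blow_up[OF diagramsD[OF p]])
    show "disjoint_family_on g ?V"
      using inj by (auto simp: disjoint_family_on_def g_def vertices_def dest: inj_onD)
    show "to_upper v \<in> g v" if "v \<in> ?V" for v
      using that by (auto simp: g_def vertices_def)
    show "W = (\<Union>v\<in>?V. g v)" unfolding UgV im by (simp add: W_def Un_assoc)
  qed
  moreover have "g v - range Mid = {map_bot \<sigma> v}" if "v \<in> ?V" for v
    using that by (auto simp: g_def vertices_def)
  ultimately show ?thesis
    using erase_middle[OF diagramsD[OF p], of g "map_bot \<sigma>"] by (simp add: dcomp_def W_def)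
qed

lemma dcomp_perm_right:
  assumes p: "p \<in> diagrams k" and \<sigma>: "\<sigma> permutes {..<k}"
  shows "dcomp k p (perm_diagram k (inv \<sigma>)) = (`) (map_top \<sigma>) ` p"
proof -
  let ?I = "{..<k}" and ?V = "vertices {..<k}"
  define W :: "nat vertex set" where "W = Top ` ?I \<union> Mid ` ?I \<union> Bot ` ?I"
  define g :: "nat vertex \<Rightarrow> nat vertex set" where
    "g = (\<lambda>v. case v of Top i \<Rightarrow> {Top (\<sigma> i), Mid i} | Mid i \<Rightarrow> {} | Bot i \<Rightarrow> {Bot i})"
  note inj = permutes_inj_on[OF \<sigma>, of ?I] and im = permutes_image[OF \<sigma>]
  have gV: "g ` ?V = (\<lambda>i. {Top (\<sigma> i), Mid i}) ` ?I \<union> (\<lambda>i. {Bot i}) ` ?I"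
    by (simp add: g_def vertices_def image_Un image_image)
  have UgV: "(\<Union>v\<in>?V. g v) = Top ` \<sigma> ` ?I \<union> Mid ` ?I \<union> Bot ` ?I"
    by (auto simp: g_def vertices_def)
  have lower: "(\<lambda>i. {Top i}) ` ?I = (\<lambda>w. {w}) ` (W - to_lower ` ?V)"
  proof -
    have "W - to_lower ` ?V = Top ` ?I" by (auto simp: W_def vertices_def image_Un image_image)
    then show ?thesis by (simp add: image_image)
  qed
  have "perm_diagram k (inv \<sigma>) = (\<lambda>i. {Top i, Bot (inv \<sigma> i)}) ` \<sigma> ` ?I"
    by (simp only: im perm_diagram_eq_image)
  also have "\<dots> = (\<lambda>i. {Top (\<sigma> i), Bot i}) ` ?I"
    by (simp add: image_image permutes_inverses[OF \<sigma>])
  finally have upper: "(\<lambda>B. to_upper ` B) ` perm_diagram k (inv \<sigma>) \<union> (\<lambda>i. {Bot i}) ` ?I = g ` ?V"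
    unfolding gV by (simp add: image_image)
  have "partition_join W ((\<lambda>B. to_upper ` B) ` perm_diagram k (inv \<sigma>) \<union> (\<lambda>i. {Bot i}) ` ?I)
      ((\<lambda>B. to_lower ` B) ` p \<union> (\<lambda>i. {Top i}) ` ?I) = (\<lambda>B. \<Union>v\<in>B. g v) ` p"
    unfolding upper lower
  proof (subst join_commute, rule join_blow_up[OF diagramsD[OF p]])
    show "disjoint_family_on g ?V"
      using inj by (auto simp: disjoint_family_on_def g_def vertices_def dest: inj_onD)
    show "to_lower v \<in> g v" if "v \<in> ?V" for v
      using that by (auto simp: g_def vertices_def)
    show "W = (\<Union>v\<in>?V. g v)" unfolding UgV im by (simp add: W_def)
  qed
  moreover have "g v - range Mid = {map_top \<sigma> v}" if "v \<in> ?V" for v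
    using that by (auto simp: g_def vertices_def)
  ultimately show ?thesis
    using erase_middle[OF diagramsD[OF p], of g "map_top \<sigma>"] by (simp add: dcomp_def W_def)
qed

text \<open>
  Composing with a permutation below moves the bottom row, composing with its inverse above moves the
  top row in the same way. Conjugation thus renames the columns.
\<close>

lemma dcomp_conjugate:
  assumes p: "p \<in> diagrams k" and \<sigma>: "\<sigma> permutes {..<k}"
  shows "dcomp k (dcomp k (perm_diagram k \<sigma>) p) (perm_diagram k (inv \<sigma>)) = relabel \<sigma> p"
proof -
  let ?V = "vertices {..<k}"
  have "map_bot \<sigma> ` ?V = ?V"
    using permutes_image[OF \<sigma>] by (simp add: vertices_def image_Un image_image flip: image_image[of Bot \<sigma>])
  moreover have "inj_on (map_bot \<sigma>) ?V"
    using permutes_inj_on[OF \<sigma>, of "{..<k}"] by (intro inj_onI) (auto simp: vertices_def dest: inj_onD)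
  ultimately have "(`) (map_bot \<sigma>) ` p \<in> diagrams k"
    using partition_on_image[OF _ diagramsD[OF p], of "map_bot \<sigma>"] by (simp add: diagrams_def)
  then have "dcomp k (dcomp k (perm_diagram k \<sigma>) p) (perm_diagram k (inv \<sigma>)) =
      (`) (map_top \<sigma>) ` (`) (map_bot \<sigma>) ` p"
    by (simp add: dcomp_perm_left[OF p \<sigma>] dcomp_perm_right[OF _ \<sigma>])
  also have "\<dots> = relabel \<sigma> p"
    unfolding relabel_eq_image image_image
  proof (intro image_cong refl)
    fix v B assume "B \<in> p" "v \<in> B"
    then have "v \<in> ?V" using partition_onD1[OF diagramsD[OF p]] by blast
    then show "map_top \<sigma> (map_bot \<sigma> v) = map_vertex \<sigma> v" by (auto simp: vertices_def)
  qed
  finally show ?thesis .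
qed

lemma map_vertex_permutes:
  assumes "\<sigma> permutes {..<k}"
  shows "map_vertex \<sigma> ` vertices {..<k} = vertices {..<k}" "inj_on (map_vertex \<sigma>) (vertices {..<k})"
  using assms by (simp_all add: map_vertex_image permutes_image permutes_inj_on inj_on_map_vertex)

lemma relabel_in:
  assumes "p \<in> diagrams k" "\<sigma> permutes {..<k}" shows "relabel \<sigma> p \<in> diagrams k"
  using partition_on_image[OF map_vertex_permutes(2)[OF assms(2)] diagramsD[OF assms(1)]]
  by (simp add: diagrams_def relabel_eq_image map_vertex_permutes(1)[OF assms(2)])

lemma relabel_comp: "relabel f (relabel g p) = relabel (f \<circ> g) p"
  by (simp add: relabel_eq_image image_image vertex.map_comp)

lemma relabel_id: "relabel id p = p"
  by (simp add: relabel_eq_image vertex.map_id)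

lemma relabel_inv:
  assumes "\<sigma> permutes S" shows "relabel \<sigma> (relabel (inv \<sigma>) p) = p" "relabel (inv \<sigma>) (relabel \<sigma> p) = p"
  by (simp_all add: relabel_comp permutes_inv_o[OF assms] relabel_id)

lemma nc_relabel: "\<sigma> permutes {..<k} \<Longrightarrow> nc (relabel \<sigma> p) = nc p"
  unfolding relabel_eq_image
  by (intro card_image inj_onI) (simp add: inj_image_eq_iff vertex.inj_map permutes_inj)

lemma djoin_relabel:
  assumes "p \<in> diagrams k" "q \<in> diagrams k" "\<sigma> permutes {..<k}"
  shows "djoin k (relabel \<sigma> p) (relabel \<sigma> q) = relabel \<sigma> (djoin k p q)"
  using join_image[OF diagramsD[OF assms(1)] diagramsD[OF assms(2)] map_vertex_permutes(2)[OF assms(3)]]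
  by (simp add: relabel_eq_image map_vertex_permutes(1)[OF assms(3)])

lemma id_diagram_relabel:
  assumes "\<sigma> permutes {..<k}" shows "relabel \<sigma> (id_diagram k) = id_diagram k"
proof -
  have "relabel \<sigma> (id_diagram k) = (\<lambda>i. {Top i, Bot i}) ` \<sigma> ` {..<k}"
    by (simp add: relabel_eq_image id_diagram_eq_image image_image)
  then show ?thesis by (simp add: permutes_image[OF assms] id_diagram_eq_image)
qed

lemma geodesic_le_relabel:
  assumes "p \<in> diagrams k" "q \<in> diagrams k" "\<sigma> permutes {..<k}"
  shows "geodesic_le k (relabel \<sigma> q) (relabel \<sigma> p) \<longleftrightarrow> geodesic_le k q p"
proof -
  have "ddist k (relabel \<sigma> r) (relabel \<sigma> s) = ddist k r s" if "r \<in> diagrams k" "s \<in> diagrams k" for r s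
    using that assms(3) by (simp add: ddist_def djoin_relabel nc_relabel)
  from this[OF id_diagram_in] this show ?thesis
    using assms by (simp add: geodesic_le_def id_diagram_relabel)
qed

section \<open>Freeness in terms of cumulants\<close>

lemma sorting_permutation:
  fixes \<epsilon> :: "nat \<Rightarrow> bool"
  obtains \<sigma> l where "\<sigma> permutes {..<k}" "l \<le> k" "\<And>i. i < k \<Longrightarrow> \<sigma> i < l \<longleftrightarrow> \<epsilon> i"
proof -
  define A where "A = {i. i < k \<and> \<epsilon> i}"
  define B where "B = {i. i < k \<and> \<not> \<epsilon> i}"
  define l where "l = card A"
  have AB: "A \<union> B = {..<k}" "A \<inter> B = {}" "finite A" "finite B" by (auto simp: A_def B_def)
  have card: "card A + card B = k" using card_Un_disjoint[OF AB(3,4,2)] AB(1) by simp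
  obtain f where f: "bij_betw f A {..<l}"
    using ex_bij_betw_finite_nat[OF AB(3)] by (auto simp: l_def lessThan_atLeast0)
  obtain g where g: "bij_betw g B {l..<k}"
    using finite_same_card_bij[OF AB(4), of "{l..<k}"] card by (auto simp: l_def)
  define h where "h = (\<lambda>i. if i \<in> A then f i else if i \<in> B then g i else i)"
  have hA: "bij_betw h A {..<l}" using f by (subst bij_betw_cong[where g = f]) (auto simp: h_def)
  have hB: "bij_betw h B {l..<k}" using g AB(2) by (subst bij_betw_cong[where g = g]) (auto simp: h_def)
  have "l \<le> k" using card by (simp add: l_def)
  then have "bij_betw h {..<k} {..<k}"
    using bij_betw_combine[OF hA hB] AB(1) by (simp add: ivl_disj_un ivl_disj_int)
  then have "h permutes {..<k}"
    by (rule bij_imp_permutes) (use AB(1) in \<open>auto simp: h_def\<close>)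
  moreover have "h i < l \<longleftrightarrow> \<epsilon> i" if "i < k" for i
  proof (cases "\<epsilon> i")
    case True
    then have "i \<in> A" using that by (simp add: A_def)
    then show ?thesis using True bij_betw_apply[OF hA] by auto
  next
    case False
    then have "i \<in> B" using that by (simp add: B_def)
    then show ?thesis using False bij_betw_apply[OF hB, of i] by auto
  qed
  ultimately show ?thesis using that \<open>l \<le> k\<close> by blast
qed

context P_tracial_algebra begin

text \<open>
  Renaming columns preserves the geodesic order, so the renamed cumulants have the renamed moments
  as their sums, and these are the original moments.
\<close>

lemma cumulant_relabel:
  assumes p: "p \<in> diagrams k" and \<sigma>: "\<sigma> permutes {..<k}" and as: "length as = k"
  shows "cumulant scale m p as = cumulant scale m (relabel \<sigma> p) (map (\<lambda>i. as ! inv \<sigma> i) [0..<k])"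
proof (rule triangular_unique[OF finite_diagrams _ _ _ p, where rank = "ddist k (id_diagram k)" and R = "geodesic_le k"])
  let ?bs = "map (\<lambda>i. as ! inv \<sigma> i) [0..<k]"
  fix p assume p: "p \<in> diagrams k"
  have "(\<Sum>q | q \<in> diagrams k \<and> geodesic_le k q p. cumulant scale m q as) = m p as"
    by (simp add: moment_eq_sum_cumulant[OF p as])
  also have "\<dots> = m (relabel \<sigma> p) ?bs"
    using conjugation[OF p \<sigma> as] by (simp add: dcomp_conjugate[OF p \<sigma>])
  also have "\<dots> = (\<Sum>q | q \<in> diagrams k \<and> geodesic_le k q (relabel \<sigma> p). cumulant scale m q ?bs)"
    by (rule moment_eq_sum_cumulant[OF relabel_in[OF p \<sigma>]]) simp
  also have "\<dots> = (\<Sum>q | q \<in> diagrams k \<and> geodesic_le k q p. cumulant scale m (relabel \<sigma> q) ?bs)"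
  proof (rule sum.reindex_bij_witness[where i = "relabel \<sigma>" and j = "relabel (inv \<sigma>)"])
    fix q assume "q \<in> {q. q \<in> diagrams k \<and> geodesic_le k q (relabel \<sigma> p)}"
    then have q: "q \<in> diagrams k" "geodesic_le k q (relabel \<sigma> p)" by auto
    show "relabel \<sigma> (relabel (inv \<sigma>) q) = q" by (rule relabel_inv[OF \<sigma>])
    have q': "relabel (inv \<sigma>) q \<in> diagrams k" using q(1) \<sigma> by (intro relabel_in permutes_inv)
    then show "relabel (inv \<sigma>) q \<in> {q. q \<in> diagrams k \<and> geodesic_le k q p}"
      using geodesic_le_relabel[OF p q' \<sigma>] q by (simp add: relabel_inv[OF \<sigma>])
  next
    fix q assume "q \<in> {q. q \<in> diagrams k \<and> geodesic_le k q p}"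
    then show "relabel (inv \<sigma>) (relabel \<sigma> q) = q"
      "relabel \<sigma> q \<in> {q. q \<in> diagrams k \<and> geodesic_le k q (relabel \<sigma> p)}"
      using p \<sigma> by (simp_all add: relabel_inv[OF \<sigma>] relabel_in geodesic_le_relabel)
  qed (simp add: relabel_inv[OF \<sigma>])
  finally show "(\<Sum>q | q \<in> diagrams k \<and> geodesic_le k q p. cumulant scale m q as) =
    (\<Sum>q | q \<in> diagrams k \<and> geodesic_le k q p. cumulant scale m (relabel \<sigma> q) ?bs)" .
qed (use reflexive_orders geodesic_le_rank in auto)

lemma cumulant_empty: "cumulant scale m {} [] = 1"
proof -
  have D: "diagrams 0 = {{}}" by (simp add: diagrams_def vertices_def partition_on_empty)
  have "{q. q \<in> diagrams 0 \<and> geodesic_le 0 q {}} = {{}}"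
    using reflexive_orders(3)[of "{}" 0] by (auto simp: D)
  then show ?thesis
    using moment_eq_sum_cumulant[of "{}" 0 "[]"] empty by (simp add: D)
qed

text \<open>
  The argument list is fixed and both sides run over all diagrams. Summing the right-hand side over
  \<open>\<sqsupset>\<close> gives the left-hand side by \<open>sum_splits\<close>, and this summation is injective.
\<close>

lemma exclusive_factorization_iff:
  assumes as: "length as = k1" and bs: "length bs = k2"
  shows "(\<forall>p\<in>diagrams (k1 + k2). exclusive_moment scale m p (as @ bs) =
      of_bool (finer_compatible (k1 + k2) (dtensor k1 (left_part k1 p) (right_part k1 k2 p)) p) *
      exclusive_moment scale m (left_part k1 p) as *
      exclusive_moment scale m (right_part k1 k2 p) bs) \<longleftrightarrow>
    (\<forall>p\<in>diagrams (k1 + k2). cumulant scale m p (as @ bs) =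
      of_bool (splits k1 k2 p) *
      (cumulant scale m (left_part k1 p) as * cumulant scale m (right_part k1 k2 p) bs))"
    (is "(\<forall>p\<in>?D. ?E p) \<longleftrightarrow> (\<forall>p\<in>?D. ?K p = ?S p)")
proof -
  have E: "?E p \<longleftrightarrow> (\<Sum>q | q \<in> ?D \<and> finer_compatible (k1 + k2) q p. ?K q) =
      (\<Sum>q | q \<in> ?D \<and> finer_compatible (k1 + k2) q p. ?S q)" if p: "p \<in> ?D" for p
    unfolding sum_splits[OF p, of "\<lambda>q. cumulant scale m q as" "\<lambda>q. cumulant scale m q bs"]
    using exclusive_moment_eq_sum_cumulant[OF p, of "as @ bs"]
      exclusive_moment_eq_sum_cumulant[OF left_part_in[OF p] as]
      exclusive_moment_eq_sum_cumulant[OF right_part_in[OF p] bs] as bs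
    by (simp only: mult.assoc length_append)
  show ?thesis
  proof
    assume *: "\<forall>p\<in>?D. ?E p"
    show "\<forall>p\<in>?D. ?K p = ?S p"
    proof
      fix p assume "p \<in> ?D"
      then show "?K p = ?S p"
        by (rule triangular_unique[OF finite_diagrams, where rank = "\<lambda>p. - int (nc p)"
              and R = "finer_compatible (k1 + k2)", rotated 3])
          (use reflexive_orders finer_compatible_rank E * in auto)
    qed
  next
    assume *: "\<forall>p\<in>?D. ?K p = ?S p"
    show "\<forall>p\<in>?D. ?E p"
    proof
      fix p assume "p \<in> ?D"
      then show "?E p" using * by (subst E) (auto intro!: sum.cong)
    qed
  qed
qed

text \<open>
  The vanishing condition of freeness concerns words in which letters of both algebras are interleaved.
  Sorting the letters reduces it to words \<open>as @ bs\<close>, where \<open>\<not> splits\<close> expresses that a cycle meets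
  both parts. The multiplicativity condition also covers empty words, where it reduces to
  \<open>cumulant_empty\<close>.
\<close>

lemma P_free_iff_cumulant_factorization:
  "P_free scale m A1 A2 \<longleftrightarrow>
    (\<forall>k1 k2. 0 < k1 \<and> 0 < k2 \<longrightarrow> (\<forall>as bs.
      length as = k1 \<and> set as \<subseteq> A1 \<and> length bs = k2 \<and> set bs \<subseteq> A2 \<longrightarrow>
      (\<forall>p\<in>diagrams (k1 + k2). cumulant scale m p (as @ bs) =
        of_bool (splits k1 k2 p) *
        (cumulant scale m (left_part k1 p) as * cumulant scale m (right_part k1 k2 p) bs))))"
    (is "_ \<longleftrightarrow> ?R")
proof
  assume free: "P_free scale m A1 A2"
  note mixed = conjunct1[OF free[unfolded P_free_def], rule_format]
    and tensor = conjunct2[OF free[unfolded P_free_def], rule_format]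
  show ?R
  proof (intro allI impI ballI)
    fix k1 k2 p as bs
    assume "length as = k1 \<and> set as \<subseteq> A1 \<and> length bs = k2 \<and> set bs \<subseteq> A2"
      and p: "p \<in> diagrams (k1 + k2)"
    then have as: "length as = k1" "set as \<subseteq> A1" and bs: "length bs = k2" "set bs \<subseteq> A2" by auto
    show "cumulant scale m p (as @ bs) = of_bool (splits k1 k2 p) *
        (cumulant scale m (left_part k1 p) as * cumulant scale m (right_part k1 k2 p) bs)"
    proof (cases "splits k1 k2 p")
      case True
      have "cumulant scale m (dtensor k1 (left_part k1 p) (right_part k1 k2 p)) (as @ bs) =
          cumulant scale m (left_part k1 p) as * cumulant scale m (right_part k1 k2 p) bs"
        by (rule tensor[OF left_part_in[OF p] right_part_in[OF p]]) (simp add: as bs)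
      then show ?thesis using True by (simp add: splits_def)
    next
      case False
      then obtain x y where "linked p x y" "(column x < k1) \<noteq> (column y < k1)"
        using splits_iff_columns[OF p] by blast
      then have "\<exists>C\<in>cycles (k1 + k2) p. \<exists>i j. Top i \<in> C \<and> Top j \<in> C \<and> (i < k1) \<noteq> (j < k1)"
        using cycle_mixes_iff[OF p, of "\<lambda>i. i < k1"] by blast
      moreover have "\<forall>i<k1 + k2. (as @ bs) ! i \<in> (if i < k1 then A1 else A2)"
        using as bs by (auto simp: nth_append subset_iff)
      moreover have "length (as @ bs) = k1 + k2" using as bs by simp
      ultimately have "cumulant scale m p (as @ bs) = 0"
        by (intro mixed[OF p, of _ "\<lambda>i. i < k1"]) (rule conjI, assumption, rule conjI)
      then show ?thesis using False by simp
    qed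
  qed
next
  assume R: ?R
  show "P_free scale m A1 A2"
    unfolding P_free_def
  proof (intro conjI allI ballI impI)
    fix k p and \<epsilon> :: "nat \<Rightarrow> bool" and as
    assume p: "p \<in> diagrams k"
      and a: "length as = k \<and> (\<forall>i<k. as ! i \<in> (if \<epsilon> i then A1 else A2)) \<and>
        (\<exists>C\<in>cycles k p. \<exists>i j. Top i \<in> C \<and> Top j \<in> C \<and> \<epsilon> i \<noteq> \<epsilon> j)"
    then have as: "length as = k" "\<And>i. i < k \<Longrightarrow> as ! i \<in> (if \<epsilon> i then A1 else A2)" by auto
    obtain x y where xy: "linked p x y" "\<epsilon> (column x) \<noteq> \<epsilon> (column y)"
      using a cycle_mixes_iff[OF p, of \<epsilon>] by blast
    have col: "column x < k" "column y < k"
      using linked_in[OF diagramsD[OF p] xy(1)] column_in by auto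
    obtain \<sigma> l where \<sigma>: "\<sigma> permutes {..<k}" "l \<le> k" "\<And>i. i < k \<Longrightarrow> \<sigma> i < l \<longleftrightarrow> \<epsilon> i"
      using sorting_permutation[of k \<epsilon>] by blast
    define q where "q = relabel \<sigma> p"
    define bs where "bs = map (\<lambda>i. as ! inv \<sigma> i) [0..<k]"
    have \<sigma>k: "\<sigma> i < k \<longleftrightarrow> i < k" for i using permutes_in_image[OF \<sigma>(1), of i] by simp
    have k: "l + (k - l) = k" using \<sigma>(2) by simp
    have q: "q \<in> diagrams (l + (k - l))" unfolding k q_def by (rule relabel_in[OF p \<sigma>(1)])
    \<comment> \<open>The sorted diagram links a column to the left of \<open>l\<close> to one on its right.\<close>
    have "linked q (map_vertex \<sigma> x) (map_vertex \<sigma> y)"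
      using xy(1) unfolding q_def relabel_eq_image linked_image by blast
    then have nsplit: "\<not> splits l (k - l) q"
      unfolding splits_iff_columns[OF q] using xy(2) \<sigma>(3) col by (metis column_map_vertex)
    have nth: "bs ! i \<in> (if i < l then A1 else A2)" if "i < k" for i
    proof -
      have s: "\<sigma> (inv \<sigma> i) = i" by (rule permutes_inverses[OF \<sigma>(1)])
      then have "inv \<sigma> i < k" using \<sigma>k[of "inv \<sigma> i"] that by simp
      then show ?thesis using as(2)[of "inv \<sigma> i"] \<sigma>(3)[of "inv \<sigma> i"] s that by (simp add: bs_def)
    qed
    have len: "length bs = k" by (simp add: bs_def)
    have "0 < l" "0 < k - l"
      using xy(2) \<sigma>(3)[OF col(1)] \<sigma>(3)[OF col(2)] col \<sigma>k[of "column x"] \<sigma>k[of "column y"] by auto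
    moreover have "set (take l bs) \<subseteq> A1"
    proof
      fix z assume "z \<in> set (take l bs)"
      then obtain i where "i < l" "i < k" "z = bs ! i" using len by (auto simp: in_set_conv_nth)
      then show "z \<in> A1" using nth[of i] by simp
    qed
    moreover have "set (drop l bs) \<subseteq> A2"
    proof
      fix z assume "z \<in> set (drop l bs)"
      then obtain i where "i < length (drop l bs)" "z = drop l bs ! i" by (auto simp: in_set_conv_nth)
      then show "z \<in> A2" using nth[of "l + i"] len by simp
    qed
    moreover have "length (take l bs) = l" "length (drop l bs) = k - l" using len \<sigma>(2) by auto
    ultimately have "cumulant scale m q (take l bs @ drop l bs) = of_bool (splits l (k - l) q) *
        (cumulant scale m (left_part l q) (take l bs) *
         cumulant scale m (right_part l (k - l) q) (drop l bs))"
      by (intro R[rule_format, OF _ _ q] conjI)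
    then have "cumulant scale m q bs = 0" using nsplit by simp
    then show "cumulant scale m p as = 0"
      using cumulant_relabel[OF p \<sigma>(1) as(1)] by (simp add: q_def bs_def)
  next
    fix k1 k2 p1 p2 as bs
    assume p1: "p1 \<in> diagrams k1" and p2: "p2 \<in> diagrams k2"
      and a: "length as = k1 \<and> set as \<subseteq> A1 \<and> length bs = k2 \<and> set bs \<subseteq> A2"
    have D0: "diagrams 0 = {{}}" by (simp add: diagrams_def vertices_def partition_on_empty)
    consider "k1 = 0" | "k2 = 0" | "0 < k1" "0 < k2" by blast
    then show "cumulant scale m (dtensor k1 p1 p2) (as @ bs) = cumulant scale m p1 as * cumulant scale m p2 bs"
    proof cases
      case 1
      moreover have "relabel (\<lambda>i. i) p2 = p2" using relabel_id[of p2] by (simp only: id_def)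
      ultimately show ?thesis using a p1 by (simp add: D0 dtensor_def cumulant_empty relabel_id)
    next
      case 2
      then show ?thesis using a p2 by (simp add: D0 dtensor_def cumulant_empty relabel_def)
    next
      case 3
      have "cumulant scale m (dtensor k1 p1 p2) (as @ bs) = of_bool (splits k1 k2 (dtensor k1 p1 p2)) *
        (cumulant scale m (left_part k1 (dtensor k1 p1 p2)) as *
         cumulant scale m (right_part k1 k2 (dtensor k1 p1 p2)) bs)"
        by (rule R[rule_format, OF _ a dtensor_in[OF p1 p2]]) (simp add: 3)
      then show ?thesis
        by (simp add: splits_dtensor[OF p1 p2] left_part_dtensor[OF p1 p2] right_part_dtensor[OF p1 p2])
    qed
  qed
qed

end

theorem theorem2p1:
  fixes scale :: "complex \<Rightarrow> 'a::ring \<Rightarrow> 'a"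
    and m :: "diagram \<Rightarrow> 'a list \<Rightarrow> complex"
    and A1 A2 :: "'a set"
  assumes "P_tracial_algebra scale m"
    and "subalgebra scale A1"
    and "subalgebra scale A2"
  shows "P_free scale m A1 A2 \<longleftrightarrow>
    (\<forall>k1 k2. 0 < k1 \<and> 0 < k2 \<longrightarrow>
      (\<forall>p\<in>diagrams (k1 + k2). \<forall>as bs.
        length as = k1 \<and> set as \<subseteq> A1 \<and> length bs = k2 \<and> set bs \<subseteq> A2 \<longrightarrow>
        exclusive_moment scale m p (as @ bs) =
          of_bool (finer_compatible (k1 + k2)
                     (dtensor k1 (left_part k1 p) (right_part k1 k2 p)) p) *
          exclusive_moment scale m (left_part k1 p) as *
          exclusive_moment scale m (right_part k1 k2 p) bs))"
proof -
  interpret P_tracial_algebra scale m by fact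
  have "P_free scale m A1 A2 \<longleftrightarrow>
    (\<forall>k1 k2. 0 < k1 \<and> 0 < k2 \<longrightarrow> (\<forall>as bs.
        length as = k1 \<and> set as \<subseteq> A1 \<and> length bs = k2 \<and> set bs \<subseteq> A2 \<longrightarrow>
        (\<forall>p\<in>diagrams (k1 + k2). exclusive_moment scale m p (as @ bs) =
          of_bool (finer_compatible (k1 + k2)
                     (dtensor k1 (left_part k1 p) (right_part k1 k2 p)) p) *
          exclusive_moment scale m (left_part k1 p) as *
          exclusive_moment scale m (right_part k1 k2 p) bs)))"
    unfolding P_free_iff_cumulant_factorization
    by (intro iff_allI imp_cong refl, rule exclusive_factorization_iff[symmetric]) simp_all
  then show ?thesis by blast
qed

end
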